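(* Let $\Gamma$ be a connected finite simplicial graph. Then there exist a right-angled Artin group $A_{\hat\Gamma}$ (for some finite simplicial graph $\hat\Gamma$) and an injective homomorphism $$A_{\hat\Gamma}\to\mathrm{PAut}(A_\Gamma)$$ whose image is a normal subgroup of $\mathrm{PAut}(A_\Gamma)$ and contains $\mathrm{Inn}(A_\Gamma)$. Moreover, if $\Gamma$ has no SIL-pair, this homomorphism is an isomorphism.
   Context: For a finite simplicial graph $\Gamma$ with vertex set $V(\Gamma)$, the right-angled Artin group $A_\Gamma$ is the group with generating set $V(\Gamma)$ and defining relations $[v,w]=1$ for every edge $vw$ of $\Gamma$. $\mathrm{PAut}(A_\Gamma)$ is the group of automorphisms of $A_\Gamma$ that send every generator $v\in V(\Gamma)$ to a conjugate of itself. $\mathrm{Inn}(A_\Gamma)$ is the group of inner automorphisms. For a vertex $v$, $\mathrm{lk}(v)$ is the set of vertices adjacent to $v$. Two distinct vertices $v,w$ form a SIL-pair if $v\notin\mathrm{lk}(w)$ and the full subgraph of $\Gamma$ on the vertices not in $\mathrm{lk}(v)\cap\mathrm{lk}(w)$ has a connected component containing neither $v$ nor $w$. *)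

theory Defs
  imports "HOL-Algebra.Bij" "HOL-Algebra.Coset" "Graph_Theory.Graph_Theory"
begin

section \<open>Groups given by generators and relators\<close>

text \<open>A letter \<open>(x, True)\<close> stands for the generator \<open>x\<close>, a letter \<open>(x, False)\<close> for its formal
  inverse.\<close>

type_synonym 'a word = "('a \<times> bool) list"

definition words :: "'a set \<Rightarrow> 'a word set"
  where "words X = lists (X \<times> UNIV)"

text \<open>The least congruence on the free monoid of words over \<open>X\<close> that makes \<open>(x, False)\<close> inverse to
  \<open>(x, True)\<close> and the relators trivial. The quotient is the group \<open>\<langle>X | r = 1 (r \<in> R)\<rangle>\<close>, i.e. the
  free group on \<open>X\<close> modulo the normal closure of \<open>R\<close>. Elements of \<open>R\<close> that are not words over \<open>X\<close>
  are ignored.\<close>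

inductive pres_eq :: "'a set \<Rightarrow> 'a word set \<Rightarrow> 'a word \<Rightarrow> 'a word \<Rightarrow> bool"
  for X :: "'a set" and R :: "'a word set"
  where
    refl: "w \<in> words X \<Longrightarrow> pres_eq X R w w"
  | sym: "pres_eq X R u v \<Longrightarrow> pres_eq X R v u"
  | trans: "pres_eq X R u v \<Longrightarrow> pres_eq X R v w \<Longrightarrow> pres_eq X R u w"
  | append: "pres_eq X R u u' \<Longrightarrow> pres_eq X R v v' \<Longrightarrow> pres_eq X R (u @ v) (u' @ v')"
  | cancel: "x \<in> X \<Longrightarrow> pres_eq X R [(x, b), (x, \<not> b)] []"
  | relator: "r \<in> R \<Longrightarrow> r \<in> words X \<Longrightarrow> pres_eq X R r []"

definition pres_rel :: "'a set \<Rightarrow> 'a word set \<Rightarrow> 'a word rel"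
  where "pres_rel X R = {(u, v). pres_eq X R u v}"

definition presented_group :: "'a set \<Rightarrow> 'a word set \<Rightarrow> 'a word set monoid"
  where "presented_group X R =
    \<lparr>carrier = words X // pres_rel X R,
     monoid.mult = (\<lambda>A B. \<Union>u\<in>A. \<Union>v\<in>B. pres_rel X R `` {u @ v}),
     one = pres_rel X R `` {[]}\<rparr>"

lemma pres_eq_words: "pres_eq X R u v \<Longrightarrow> u \<in> words X \<and> v \<in> words X"
  by (induction rule: pres_eq.induct) (auto simp: words_def)

lemma equiv_pres_rel: "equiv (words X) (pres_rel X R)"
proof (rule equivI)
  show "pres_rel X R \<subseteq> words X \<times> words X"
    by (auto simp: pres_rel_def dest: pres_eq_words)
  show "refl_on (words X) (pres_rel X R)"
    by (auto simp: refl_on_def pres_rel_def intro: pres_eq.refl)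
  show "Relation.sym (pres_rel X R)"
    by (auto simp: sym_def pres_rel_def intro: pres_eq.sym)
  show "Relation.trans (pres_rel X R)"
    by (auto simp: trans_def pres_rel_def intro: pres_eq.trans)
qed

lemma presented_group_mult:
  assumes "u \<in> words X" "v \<in> words X"
  shows "pres_rel X R `` {u} \<otimes>\<^bsub>presented_group X R\<^esub> pres_rel X R `` {v} = pres_rel X R `` {u @ v}"
proof -
  have "(\<lambda>u v. pres_rel X R `` {u @ v}) respects2 pres_rel X R"
    by (rule congruent2I', rule equiv_class_eq[OF equiv_pres_rel])
       (auto simp: pres_rel_def intro: pres_eq.append)
  from UN_equiv_class2[OF equiv_pres_rel equiv_pres_rel this assms]
  show ?thesis by (simp add: presented_group_def)
qed

lemma group_presented_group: "group (presented_group X R)"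
proof -
  let ?G = "presented_group X R" and ?c = "\<lambda>u. pres_rel X R `` {u}"
  have carr: "A \<in> carrier ?G \<longleftrightarrow> (\<exists>u\<in>words X. A = ?c u)" for A
    by (auto simp: presented_group_def quotient_def)
  have app: "u @ v \<in> words X" if "u \<in> words X" "v \<in> words X" for u v
    using that by (auto simp: words_def)
  have nil: "[] \<in> words X" by (simp add: words_def)
  have one: "\<one>\<^bsub>?G\<^esub> = ?c []" by (simp add: presented_group_def)
  have inverse: "\<exists>u'\<in>words X. pres_eq X R (u' @ u) []" if "u \<in> words X" for u
    using that
  proof (induction u)
    case Nil
    show ?case using nil pres_eq.refl by fastforce
  next
    case (Cons a u)
    obtain x b where a: "a = (x, b)" by fastforce
    with Cons have x: "x \<in> X" and u: "u \<in> words X" by (auto simp: words_def)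
    from Cons.IH[OF u] obtain u' where u': "u' \<in> words X" "pres_eq X R (u' @ u) []" by blast
    from pres_eq.cancel[OF x, of R "\<not> b"] have "pres_eq X R [(x, \<not> b), (x, b)] []" by simp
    from pres_eq.append[OF pres_eq.append[OF pres_eq.refl[OF u'(1)] this] pres_eq.refl[OF u]]
    have "pres_eq X R ((u' @ [(x, \<not> b)]) @ a # u) (u' @ u)" by (simp add: a)
    from pres_eq.trans[OF this u'(2)] have "pres_eq X R ((u' @ [(x, \<not> b)]) @ a # u) []" .
    moreover have "u' @ [(x, \<not> b)] \<in> words X" using u' x by (auto simp: words_def)
    ultimately show ?case by blast
  qed
  show ?thesis
  proof (rule groupI)
    fix A assume "A \<in> carrier ?G"
    then obtain u where u: "u \<in> words X" "A = ?c u" by (auto simp: carr)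
    from inverse[OF u(1)] obtain u' where u': "u' \<in> words X" "pres_eq X R (u' @ u) []" by blast
    then have "?c (u' @ u) = ?c []"
      by (intro equiv_class_eq[OF equiv_pres_rel]) (simp add: pres_rel_def)
    with u u' show "\<exists>B\<in>carrier ?G. B \<otimes>\<^bsub>?G\<^esub> A = \<one>\<^bsub>?G\<^esub>"
      using carr one presented_group_mult by metis
  qed (use nil app in \<open>auto simp: carr one presented_group_mult\<close>)
qed


section \<open>Right-angled Artin groups\<close>

text \<open>A finite simplicial graph is a \<^locale>\<open>pair_graph\<close>: finitely many vertices, and a
  symmetric irreflexive set of ordered pairs of vertices, an edge \<open>vw\<close> being represented by both
  \<open>(v, w)\<close> and \<open>(w, v)\<close>.\<close>

definition commutator_word :: "'a \<Rightarrow> 'a \<Rightarrow> 'a word"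
  where "commutator_word v w = [(v, True), (w, True), (v, False), (w, False)]"

definition raag_relators :: "'a pair_pre_digraph \<Rightarrow> 'a word set"
  where "raag_relators \<Gamma> = {commutator_word v w | v w. (v, w) \<in> parcs \<Gamma>}"

definition RAAG :: "'a pair_pre_digraph \<Rightarrow> 'a word set monoid"
  where "RAAG \<Gamma> = presented_group (pverts \<Gamma>) (raag_relators \<Gamma>)"

definition raag_gen :: "'a pair_pre_digraph \<Rightarrow> 'a \<Rightarrow> 'a word set"
  where "raag_gen \<Gamma> v = pres_rel (pverts \<Gamma>) (raag_relators \<Gamma>) `` {[(v, True)]}"

lemma group_RAAG: "group (RAAG \<Gamma>)"
  by (simp add: RAAG_def group_presented_group)


section \<open>Automorphisms\<close>

text \<open>Following \<^const>\<open>auto\<close>, an automorphism of \<open>G\<close> is extensional, that is, it takes the value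
  \<^const>\<open>undefined\<close> outside the carrier. Hence the restriction in the definition of the inner
  automorphisms.\<close>

definition Inn :: "('a, 'b) monoid_scheme \<Rightarrow> ('a \<Rightarrow> 'a) set"
  where "Inn G = (\<lambda>g. \<lambda>x\<in>carrier G. g \<otimes>\<^bsub>G\<^esub> x \<otimes>\<^bsub>G\<^esub> inv\<^bsub>G\<^esub> g) ` carrier G"

definition PAut :: "'a pair_pre_digraph \<Rightarrow> ('a word set \<Rightarrow> 'a word set) monoid"
  where "PAut \<Gamma> = AutoGroup (RAAG \<Gamma>)
    \<lparr>carrier := {f \<in> auto (RAAG \<Gamma>). \<forall>v\<in>pverts \<Gamma>. \<exists>g\<in>carrier (RAAG \<Gamma>).
       f (raag_gen \<Gamma> v) = g \<otimes>\<^bsub>RAAG \<Gamma>\<^esub> raag_gen \<Gamma> v \<otimes>\<^bsub>RAAG \<Gamma>\<^esub> inv\<^bsub>RAAG \<Gamma>\<^esub> g}\<rparr>"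


section \<open>SIL-pairs\<close>

definition link :: "'a pair_pre_digraph \<Rightarrow> 'a \<Rightarrow> 'a set"
  where "link \<Gamma> v = {u. (v, u) \<in> parcs \<Gamma>}"

text \<open>In a symmetric digraph the strongly connected components are the connected components.\<close>

definition SIL_pair :: "'a pair_pre_digraph \<Rightarrow> 'a \<Rightarrow> 'a \<Rightarrow> bool"
  where "SIL_pair \<Gamma> v w \<longleftrightarrow>
    v \<in> pverts \<Gamma> \<and> w \<in> pverts \<Gamma> \<and> v \<noteq> w \<and> v \<notin> link \<Gamma> w \<and>
    (\<exists>C \<in> pre_digraph.sccs (with_proj \<Gamma> \<restriction> (pverts \<Gamma> - link \<Gamma> v \<inter> link \<Gamma> w)).
       v \<notin> verts C \<and> w \<notin> verts C)"

end

theory Submission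
  imports Defs
begin

text \<open>If \<open>\<Gamma>\<close> has a SIL-pair, the image is taken to be the group of inner automorphisms. Otherwise it
  is the whole of \<open>PAut\<close>, with the partial conjugations by vertices \<open>x\<close> of the components of
  \<open>\<Gamma> - st x\<close> as generators. Both cases are instances of one construction: choose for every \<open>x\<close> a
  partition of \<open>\<Gamma> - st x\<close> into unions of components (a single part in the first case), let the
  generators be the pairs \<open>(x, C)\<close> with \<open>C\<close> a part of \<open>x\<close>, and let \<open>(x, C)\<close>, \<open>(y, D)\<close> commute
  unless \<open>y \<in> C\<close> and \<open>x \<in> D\<close>.

  Injectivity: let \<open>z x\<close> be the product of the generators \<open>(x, C)\<close>, which acts as conjugation by
  \<open>x\<close>. The subgroup generated by the \<open>z x\<close> is normal with abelian quotient. The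
  exponents of an element of the kernel vanish, as they can be read off from conjugators of the
  images of the generators; hence it is of the form \<open>z g\<close> with \<open>g\<close> central. The center is
  generated by the cone vertices, and \<open>z\<close> kills those.

  Surjectivity is Laurence's theorem. Write \<open>\<phi> x = w\<^sub>x x w\<^sub>x\<^sup>-\<^sup>1\<close> with \<open>w\<^sub>x\<close> as short as
  possible. If no \<open>w\<^sub>y\<close> lies in a halfspace of the Cayley graph bounded by a wall of
  \<open>\<phi> x\<close> with \<open>x\<close>, \<open>y\<close> not adjacent, then ping-pong on these halfspaces shows \<open>\<phi> = id\<close>. Otherwise a
  partial conjugation of the component of \<open>y\<close> in \<open>\<Gamma> - st x\<close> shortens the conjugators.\<close>

section \<open>Words and generators\<close>

text \<open>A discrete intermediate value principle. Reading \<open>u\<close> as a path, it finds an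
  edge at which the path enters the region described by \<open>P\<close>.\<close>

lemma split_at_first_entry:
  assumes "\<not> P []" and "P u"
  obtains p l q where "u = p @ l # q" "\<not> P p" "P (p @ [l])"
proof -
  have "\<exists>p l q. u = p @ l # q \<and> \<not> P p \<and> P (p @ [l])" using assms(2)
  proof (induction u rule: rev_induct)
    case Nil
    with assms(1) show ?case by blast
  next
    case (snoc l u)
    show ?case
    proof (cases "P u")
      case True
      then obtain p l' q where "u = p @ l' # q" "\<not> P p" "P (p @ [l'])" using snoc.IH by blast
      then have "u @ [l] = p @ l' # (q @ [l])" by simp
      with \<open>\<not> P p\<close> \<open>P (p @ [l'])\<close> show ?thesis by blast
    next
      case False
      with snoc.prems show ?thesis by blast
    qed
  qed
  with that show thesis by blast
qed

definition bar :: "'a \<times> bool \<Rightarrow> 'a \<times> bool"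
  where "bar s = (fst s, \<not> snd s)"

lemma bar_simps [simp]:
  "fst (bar s) = fst s" "snd (bar s) = (\<not> snd s)" "bar (bar s) = s" "bar s \<noteq> s" "s \<noteq> bar s"
  "bar (x, b) = (x, \<not> b)"
  by (auto simp: bar_def prod_eq_iff)

lemma words_simps [simp]:
  "[] \<in> words X"
  "l # u \<in> words X \<longleftrightarrow> fst l \<in> X \<and> u \<in> words X"
  "u @ v \<in> words X \<longleftrightarrow> u \<in> words X \<and> v \<in> words X"
  by (auto simp: words_def mem_Times_iff)

lemma words_mono: "u \<in> words X \<Longrightarrow> X \<subseteq> Y \<Longrightarrow> u \<in> words Y"
  by (auto simp: words_def)

context group
begin

lemma inv_mult_cancel [simp]:
  assumes "a \<in> carrier G" "b \<in> carrier G"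
  shows "inv a \<otimes> (a \<otimes> b) = b" "a \<otimes> (inv a \<otimes> b) = b"
  using assms by (simp_all flip: m_assoc)

lemma commute_inv:
  assumes "a \<in> carrier G" "b \<in> carrier G" "a \<otimes> b = b \<otimes> a"
  shows "inv a \<otimes> b = b \<otimes> inv a"
proof -
  have "inv a \<otimes> b = inv a \<otimes> (b \<otimes> a) \<otimes> inv a" using assms(1,2) by (simp add: m_assoc)
  also have "\<dots> = b \<otimes> inv a" using assms(1,2) by (simp add: m_assoc flip: assms(3))
  finally show ?thesis .
qed

lemma commute_mult:
  assumes "a \<in> carrier G" "b \<in> carrier G" "c \<in> carrier G" "a \<otimes> b = b \<otimes> a" "a \<otimes> c = c \<otimes> a"
  shows "a \<otimes> (b \<otimes> c) = (b \<otimes> c) \<otimes> a"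
  using assms by (metis m_assoc)

end

locale raag =
  fixes \<Gamma> :: "'a pair_pre_digraph" and G (structure)
  assumes pair_graph: "pair_graph \<Gamma>" and G_def: "G = RAAG \<Gamma>"

sublocale raag \<subseteq> group G
  by (simp add: G_def group_RAAG)

context raag
begin

abbreviation V where "V \<equiv> pverts \<Gamma>"
abbreviation lk where "lk \<equiv> link \<Gamma>"
definition st where "st v = insert v (lk v)"
definition cl where "cl u = pres_rel V (raag_relators \<Gamma>) `` {u}"
abbreviation L where "L l \<equiv> cl [l]"

lemma finite_V: "finite V"
proof -
  interpret pair_graph \<Gamma> by (rule pair_graph)
  show ?thesis by simp
qed

lemma lk_V: "w \<in> lk v \<Longrightarrow> v \<in> V" "w \<in> lk v \<Longrightarrow> w \<in> V"
proof -
  interpret pair_graph \<Gamma> by (rule pair_graph)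
  show "w \<in> lk v \<Longrightarrow> v \<in> V" "w \<in> lk v \<Longrightarrow> w \<in> V"
    by (auto simp: link_def dest: arc_fst_in_verts arc_snd_in_verts)
qed

lemma lk_subset: "lk v \<subseteq> V" by (auto dest: lk_V)

lemma st_subset: "v \<in> V \<Longrightarrow> st v \<subseteq> V" by (auto simp: st_def dest: lk_V)

lemma lk_sym: "w \<in> lk v \<longleftrightarrow> v \<in> lk w"
proof -
  interpret pair_graph \<Gamma> by (rule pair_graph)
  show ?thesis using pair_sym_arcs
    by (auto simp: link_def symmetric_conv)
qed

lemma lk_irrefl [simp]: "v \<notin> lk v"
proof -
  interpret pair_graph \<Gamma> by (rule pair_graph)
  show ?thesis by (auto simp: link_def dest: pair_no_loops)
qed

lemma st_sym: "w \<in> st v \<longleftrightarrow> v \<in> st w"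
  using lk_sym by (auto simp: st_def)

lemma st_refl [simp]: "v \<in> st v" by (simp add: st_def)

lemma cl_eq_iff: "u \<in> words V \<Longrightarrow> cl u = cl v \<longleftrightarrow> pres_eq V (raag_relators \<Gamma>) u v"
  using eq_equiv_class_iff[OF equiv_pres_rel, of u V v "raag_relators \<Gamma>"]
    pres_eq_words[of V "raag_relators \<Gamma>" u v]
  by (metis (mono_tags, lifting) Image_singleton_iff cl_def case_prodD equiv_class_eq_iff
      equiv_pres_rel mem_Collect_eq pres_rel_def case_prodI)

lemma carrier_eq: "carrier G = cl ` words V"
  by (auto simp: G_def RAAG_def presented_group_def quotient_def cl_def)

lemma cl_closed [simp]: "u \<in> words V \<Longrightarrow> cl u \<in> carrier G"
  by (simp add: carrier_eq)

lemma cl_append: "u \<in> words V \<Longrightarrow> v \<in> words V \<Longrightarrow> cl (u @ v) = cl u \<otimes> cl v"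
  by (simp add: G_def RAAG_def cl_def presented_group_mult)

lemma cl_Nil [simp]: "cl [] = \<one>"
  by (simp add: G_def RAAG_def cl_def presented_group_def)

lemma cl_Cons: "fst l \<in> V \<Longrightarrow> u \<in> words V \<Longrightarrow> cl (l # u) = L l \<otimes> cl u"
  using cl_append[of "[l]" u] by simp

lemma cl_Cons_Cons:
  "fst l \<in> V \<Longrightarrow> fst m \<in> V \<Longrightarrow> u \<in> words V \<Longrightarrow> cl (l # m # u) = L l \<otimes> cl (m # u)"
  using cl_Cons[of l "m # u"] by simp

lemma raag_gen_eq: "raag_gen \<Gamma> v = L (v, True)"
  by (simp add: raag_gen_def cl_def)

lemma elem_cases:
  assumes "g \<in> carrier G"
  obtains u where "u \<in> words V" "g = cl u"
  using assms carrier_eq by auto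

lemma L_bar_mult [simp]: "fst l \<in> V \<Longrightarrow> L l \<otimes> L (bar l) = \<one>"
  using cl_append[of "[l]" "[bar l]"] pres_eq.cancel[of "fst l" V "raag_relators \<Gamma>" "snd l"]
    cl_eq_iff[of "[l, bar l]" "[]"]
  by (simp add: bar_def)

lemma L_bar: "fst l \<in> V \<Longrightarrow> L (bar l) = inv (L l)"
  using inv_equality[of "L (bar l)" "L l"] L_bar_mult[of "bar l"] by simp

lemma L_False: "v \<in> V \<Longrightarrow> L (v, False) = inv (L (v, True))"
  using L_bar[of "(v, True)"] by simp

lemma gen_commute:
  assumes "w \<in> lk v"
  shows "L (v, True) \<otimes> L (w, True) = L (w, True) \<otimes> L (v, True)"
proof -
  have V: "v \<in> V" "w \<in> V" using assms lk_V by auto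
  have "commutator_word v w \<in> raag_relators \<Gamma>"
    using assms by (auto simp: raag_relators_def link_def)
  moreover have "commutator_word v w \<in> words V" using V by (simp add: commutator_word_def)
  ultimately have "cl (commutator_word v w) = cl []"
    using cl_eq_iff pres_eq.relator by metis
  then have "L (v, True) \<otimes> L (w, True) \<otimes> inv (L (v, True)) \<otimes> inv (L (w, True)) = \<one>"
    using V by (simp add: commutator_word_def cl_Cons_Cons L_False m_assoc)
  then have "L (v, True) \<otimes> L (w, True) \<otimes> inv (L (w, True) \<otimes> L (v, True)) = \<one>"
    using V by (simp add: inv_mult_group m_assoc)
  then show ?thesis
    using V inv_equality[of "L (v, True) \<otimes> L (w, True)" "inv (L (w, True) \<otimes> L (v, True))"] by simp
qed

lemma L_commute:
  assumes "fst l \<in> st (fst s)" "fst s \<in> V"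
  shows "L l \<otimes> L s = L s \<otimes> L l"
proof -
  obtain v b w c where eq: "l = (v, b)" "s = (w, c)" by fastforce
  have V: "v \<in> V" "w \<in> V" using assms eq st_subset by auto
  have T: "L (v, True) \<otimes> L (w, True) = L (w, True) \<otimes> L (v, True)"
    using assms gen_commute[of w v] lk_sym unfolding eq st_def by auto
  have c: "L (v, True) \<in> carrier G" "L (w, True) \<in> carrier G" using V by auto
  have T2: "L (v, b) \<otimes> L (w, True) = L (w, True) \<otimes> L (v, b)"
    using T commute_inv[OF c T] V by (cases b) (simp_all add: L_False)
  moreover have "L (v, b) \<in> carrier G" using V by simp
  ultimately show ?thesis
    using V c commute_inv[of "L (w, True)" "L (v, b)"] by (cases c) (simp_all add: L_False eq)
qed

lemma gen_induct [consumes 1, case_names one mult]: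
  assumes "g \<in> carrier G" and "P \<one>"
    and "\<And>l g. fst l \<in> V \<Longrightarrow> g \<in> carrier G \<Longrightarrow> P g \<Longrightarrow> P (L l \<otimes> g)"
  shows "P g"
proof -
  have "P (cl u)" if "u \<in> words V" for u
    using that
  proof (induction u)
    case (Cons l u)
    then show ?case using cl_Cons[of l u] assms(3) by simp
  qed (simp add: assms)
  with assms(1) show ?thesis by (auto simp: carrier_eq)
qed

lemma hom_eqI:
  assumes "group H" "\<phi> \<in> hom G H" "\<psi> \<in> hom G H"
    and "\<And>v. v \<in> V \<Longrightarrow> \<phi> (L (v, True)) = \<psi> (L (v, True))" and "g \<in> carrier G"
  shows "\<phi> g = \<psi> g"
proof -
  interpret H: group H by fact
  interpret a: group_hom G H \<phi> using assms by unfold_locales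
  interpret b: group_hom G H \<psi> using assms by unfold_locales
  have l: "\<phi> (L l) = \<psi> (L l)" if "fst l \<in> V" for l
  proof (cases l)
    case (Pair v b)
    with that assms(4)[of v] show ?thesis by (cases b) (auto simp: L_False)
  qed
  show ?thesis using assms(5) by (induction rule: gen_induct) (auto simp: l)
qed

end

section \<open>Universal property of the presentation\<close>

fun eval_word :: "('b, 'c) monoid_scheme \<Rightarrow> ('a \<Rightarrow> 'b) \<Rightarrow> 'a word \<Rightarrow> 'b" where
  "eval_word H f [] = \<one>\<^bsub>H\<^esub>"
| "eval_word H f (l # u) =
    (if snd l then f (fst l) else inv\<^bsub>H\<^esub> f (fst l)) \<otimes>\<^bsub>H\<^esub> eval_word H f u"

context raag
begin

text \<open>Evaluation of words respects cancellation and the commutators, so it factors through the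
  classes. The extensional version is provided because elements of \<open>PAut \<Gamma>\<close> are
  extensional.\<close>

lemma lift_hom:
  fixes H :: "('b, 'c) monoid_scheme" and f :: "'a \<Rightarrow> 'b"
  assumes "group H" and f: "\<And>v. v \<in> V \<Longrightarrow> f v \<in> carrier H"
    and comm: "\<And>v w. w \<in> lk v \<Longrightarrow> f v \<otimes>\<^bsub>H\<^esub> f w = f w \<otimes>\<^bsub>H\<^esub> f v"
  obtains \<phi> where "\<phi> \<in> hom G H" "\<phi> \<in> extensional (carrier G)"
    "\<And>v. v \<in> V \<Longrightarrow> \<phi> (L (v, True)) = f v"
proof -
  interpret H: group H by fact
  let ?e = "eval_word H f"
  have closed: "?e u \<in> carrier H" if "u \<in> words V" for u
    using that by (induction u) (auto simp: f)
  have app: "?e (u @ v) = ?e u \<otimes>\<^bsub>H\<^esub> ?e v" if "u \<in> words V" "v \<in> words V" for u v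
    using that by (induction u) (auto simp: f closed H.m_assoc)
  have resp: "?e u = ?e v" if "pres_eq V (raag_relators \<Gamma>) u v" for u v
    using that
  proof induction
    case (append u u' v v')
    then show ?case using app pres_eq_words by metis
  next
    case (relator r)
    then obtain v w where r: "r = commutator_word v w" "w \<in> lk v"
      by (auto simp: raag_relators_def link_def)
    have V: "v \<in> V" "w \<in> V" using r lk_V by auto
    have "?e r = f v \<otimes>\<^bsub>H\<^esub> f w \<otimes>\<^bsub>H\<^esub> inv\<^bsub>H\<^esub> f v \<otimes>\<^bsub>H\<^esub> inv\<^bsub>H\<^esub> f w"
      using V f by (simp add: r commutator_word_def H.m_assoc)
    also have "\<dots> = f w \<otimes>\<^bsub>H\<^esub> f v \<otimes>\<^bsub>H\<^esub> inv\<^bsub>H\<^esub> f v \<otimes>\<^bsub>H\<^esub> inv\<^bsub>H\<^esub> f w"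
      by (simp only: comm[OF r(2)])
    also have "\<dots> = \<one>\<^bsub>H\<^esub>" using V f by (simp add: H.m_assoc)
    finally show ?case by simp
  qed (auto simp: f)
  \<comment> \<open>A class is evaluated on an arbitrary representative; by \<open>resp\<close> the
    choice does not matter.\<close>
  define \<phi> where "\<phi> = (\<lambda>A\<in>carrier G. ?e (SOME u. u \<in> words V \<and> A = cl u))"
  have \<phi>: "\<phi> (cl u) = ?e u" if "u \<in> words V" for u
  proof -
    let ?v = "SOME v. v \<in> words V \<and> cl u = cl v"
    have "?v \<in> words V \<and> cl u = cl ?v" using that by (rule_tac someI) auto
    then show ?thesis using resp cl_eq_iff that unfolding \<phi>_def by auto
  qed
  show thesis
  proof (rule that)
    show "\<phi> \<in> hom G H"
    proof (rule homI)
      fix g h assume "g \<in> carrier G" "h \<in> carrier G"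
      then obtain u v where "u \<in> words V" "v \<in> words V" "g = cl u" "h = cl v"
        using elem_cases by metis
      then show "\<phi> (g \<otimes> h) = \<phi> g \<otimes>\<^bsub>H\<^esub> \<phi> h" using \<phi> app cl_append by (metis words_simps(3))
    qed (use \<phi> closed elem_cases in metis)
    show "\<phi> \<in> extensional (carrier G)" by (simp add: \<phi>_def)
    show "\<phi> (L (v, True)) = f v" if "v \<in> V" for v
      using that \<phi>[of "[(v, True)]"] f by simp
  qed
qed

section \<open>Special subgroups and exponent sums\<close>

definition sub :: "'a set \<Rightarrow> 'a word set set" where "sub S = cl ` words S"
abbreviation K where "K x \<equiv> sub (lk x)"

lemma sub_carrier: "S \<subseteq> V \<Longrightarrow> sub S \<subseteq> carrier G"
  unfolding sub_def by (blast intro: words_mono cl_closed)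

lemma sub_one [simp]: "\<one> \<in> sub S"
  unfolding sub_def by (metis cl_Nil imageI words_simps(1))

lemma sub_mult: 
  assumes "S \<subseteq> V" "g \<in> sub S" "h \<in> sub S"
  shows "g \<otimes> h \<in> sub S"
proof -
  obtain u v where "u \<in> words S" "v \<in> words S" "g = cl u" "h = cl v"
    using assms by (auto simp: sub_def)
  moreover have "u \<in> words V" "v \<in> words V" using calculation assms(1) words_mono by auto
  ultimately show ?thesis unfolding sub_def by (metis cl_append imageI words_simps(3))
qed

lemma L_in_sub [simp]: "fst l \<in> S \<Longrightarrow> L l \<in> sub S"
  by (auto simp: sub_def)

lemma sub_inv:
  assumes "S \<subseteq> V" "g \<in> sub S"
  shows "inv g \<in> sub S"
proof -
  have "inv (cl u) \<in> sub S" if "u \<in> words S" for u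
    using that
  proof (induction u)
    case (Cons l u)
    then have u: "u \<in> words V" "fst l \<in> V" using assms(1) words_mono by auto
    have "inv (cl (l # u)) = inv (cl u) \<otimes> L (bar l)"
      using u cl_Cons[of l u] by (simp add: inv_mult_group L_bar)
    then show ?case using Cons assms(1) by (simp add: sub_mult)
  qed simp
  with assms show ?thesis by (auto simp: sub_def)
qed

lemma sub_mult_cancel_right:
  assumes "S \<subseteq> V" "k \<in> sub S" "g \<in> carrier G"
  shows "g \<otimes> k \<in> sub S \<longleftrightarrow> g \<in> sub S"
proof
  have k: "k \<in> carrier G" using assms sub_carrier by blast
  assume "g \<otimes> k \<in> sub S"
  then have "g \<otimes> k \<otimes> inv k \<in> sub S" using assms sub_mult sub_inv by blast
  then show "g \<in> sub S" using k assms by (simp add: m_assoc)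
qed (use assms sub_mult in blast)

lemma sub_mult_cancel_left:
  assumes "S \<subseteq> V" "k \<in> sub S" "g \<in> carrier G"
  shows "k \<otimes> g \<in> sub S \<longleftrightarrow> g \<in> sub S"
proof
  have k: "k \<in> carrier G" using assms sub_carrier by blast
  assume "k \<otimes> g \<in> sub S"
  then have "inv k \<otimes> (k \<otimes> g) \<in> sub S" using assms sub_mult sub_inv by blast
  then show "g \<in> sub S" using k assms by simp
qed (use assms sub_mult in blast)

lemma K_carrier: "k \<in> K x \<Longrightarrow> k \<in> carrier G"
  using sub_carrier[OF lk_subset] by blast

lemma sub_commute:
  assumes "k \<in> sub (st (fst s))" "fst s \<in> V"
  shows "k \<otimes> L s = L s \<otimes> k"
proof -
  obtain u where u: "u \<in> words (st (fst s))" "k = cl u" using assms by (auto simp: sub_def)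
  from u(1) have "cl u \<otimes> L s = L s \<otimes> cl u"
  proof (induction u)
    case (Cons l u)
    then have V: "fst l \<in> V" "u \<in> words V"
      using st_subset[OF assms(2)] words_mono[OF _ st_subset[OF assms(2)]] by auto
    have "L s \<otimes> (L l \<otimes> cl u) = (L l \<otimes> cl u) \<otimes> L s"
      using Cons V assms L_commute[of l s] by (intro commute_mult) simp_all
    then show ?case using cl_Cons[OF V] by simp
  qed (use assms in simp)
  with u show ?thesis by simp
qed

lemma K_sub_st: "K x \<subseteq> sub (st x)"
  unfolding sub_def st_def using words_mono[of _ "lk x" "insert x (lk x)"] by blast

lemma K_commute: "k \<in> K (fst s) \<Longrightarrow> fst s \<in> V \<Longrightarrow> k \<otimes> L s = L s \<otimes> k"
  using sub_commute K_sub_st by blast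

section \<open>Exponent sums\<close>

fun word_expo :: "'a \<Rightarrow> 'a word \<Rightarrow> int" where
  "word_expo x [] = 0"
| "word_expo x (l # u) = (if fst l = x then if snd l then 1 else - 1 else 0) + word_expo x u"

lemma word_expo_append: "word_expo x (u @ v) = word_expo x u + word_expo x v"
  by (induction u) auto

text \<open>Commutators have exponent sum zero in every vertex. Hence \<open>expo\<close>, read off
  from a chosen representative, is well defined and additive.\<close>

lemma word_expo_pres_eq: "pres_eq V (raag_relators \<Gamma>) u v \<Longrightarrow> word_expo x u = word_expo x v"
  by (induction rule: pres_eq.induct)
    (auto simp: word_expo_append raag_relators_def commutator_word_def)

definition expo :: "'a \<Rightarrow> 'a word set \<Rightarrow> int"
  where "expo x g = word_expo x (SOME u. u \<in> words V \<and> g = cl u)"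

lemma expo_cl: 
  assumes "u \<in> words V"
  shows "expo x (cl u) = word_expo x u"
proof -
  let ?v = "SOME v. v \<in> words V \<and> cl u = cl v"
  have "?v \<in> words V \<and> cl u = cl ?v" using assms by (rule_tac someI) auto
  then show ?thesis using word_expo_pres_eq cl_eq_iff assms unfolding expo_def by metis
qed

lemma expo_one [simp]: "expo x \<one> = 0"
  using expo_cl[of "[]"] by simp

lemma expo_mult [simp]: 
  assumes "g \<in> carrier G" "h \<in> carrier G"
  shows "expo x (g \<otimes> h) = expo x g + expo x h"
proof -
  obtain u v where "u \<in> words V" "v \<in> words V" "g = cl u" "h = cl v"
    using assms elem_cases by metis
  then show ?thesis by (simp add: expo_cl word_expo_append flip: cl_append)
qed

lemma expo_inv [simp]:
  assumes "g \<in> carrier G"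
  shows "expo x (inv g) = - expo x g"
  using expo_mult[of g "inv g" x] assms by simp

lemma expo_sub: 
  assumes "g \<in> sub S" "S \<subseteq> V" "x \<notin> S"
  shows "expo x g = 0"
proof -
  obtain u where u: "u \<in> words S" "g = cl u" using assms by (auto simp: sub_def)
  have "word_expo x u = 0" using u(1) by (induction u) (use assms(3) in auto)
  then show ?thesis using u assms expo_cl words_mono by metis
qed

lemma L_notin_sub:
  assumes "S \<subseteq> V" "fst s \<in> V" "fst s \<notin> S"
  shows "L s \<notin> sub S"
  using expo_sub[of "L s" S "fst s"] expo_cl[of "[s]" "fst s"] assms by (auto split: if_splits)

section \<open>Walls and halfspaces\<close>

text \<open>The wall of \<open>x\<close> is dual to the edges from \<open>k\<close> to \<open>k x\<close> of the Cayley graph, where \<open>k\<close> runs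
  through \<^term>\<open>K x\<close>. For a path starting at \<open>h\<close> this is the parity of the number of its crossings.
  It only depends on the endpoints of the path, since the relators are closed paths with even
  crossing numbers.\<close>

fun wall_parity :: "'a \<Rightarrow> 'a word set \<Rightarrow> 'a word \<Rightarrow> bool" where
  "wall_parity x h [] \<longleftrightarrow> False"
| "wall_parity x h (l # u) \<longleftrightarrow>
    (fst l = x \<and> (if snd l then h \<in> K x else h \<otimes> L l \<in> K x)) \<noteq> wall_parity x (h \<otimes> L l) u"

lemma wall_parity_append:
  assumes "u \<in> words V" "v \<in> words V" "h \<in> carrier G"
  shows "wall_parity x h (u @ v) \<longleftrightarrow> wall_parity x h u \<noteq> wall_parity x (h \<otimes> cl u) v"
  using assms
proof (induction u arbitrary: h)
  case (Cons l u)
  then have "h \<otimes> cl (l # u) = h \<otimes> L l \<otimes> cl u" by (simp add: cl_Cons[of l u] m_assoc)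
  then show ?case using Cons by auto
qed auto

lemma wall_parity_pres_eq:
  assumes "pres_eq V (raag_relators \<Gamma>) u v" and "h \<in> carrier G"
  shows "wall_parity x h u = wall_parity x h v"
  using assms
proof (induction arbitrary: h)
  case (append u u' v v')
  then have w: "u \<in> words V" "u' \<in> words V" "v \<in> words V" "v' \<in> words V"
    using append.hyps by (blast dest: pres_eq_words)+
  moreover have "cl u = cl u'" using append w cl_eq_iff by blast
  ultimately show ?case using append by (simp add: wall_parity_append)
next
  \<comment> \<open>Backtracking crosses the same edge twice.\<close>
  case (cancel y b)
  have "h \<otimes> L (y, b) \<otimes> L (y, \<not> b) = h"
    using L_bar_mult[of "(y, b)"] cancel by (simp add: m_assoc)
  then show ?case by auto
next
  case (relator r)
  then obtain v w where r: "r = commutator_word v w" "w \<in> lk v"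
    by (auto simp: raag_relators_def link_def)
  have V: "v \<in> V" "w \<in> V" using r lk_V by auto
  have vw: "v \<noteq> w" "v \<in> lk w" using r lk_sym by auto
  have com: "L (v, b) \<otimes> L (w, c) = L (w, c) \<otimes> L (v, b)" for b c
    using L_commute[of "(v, b)" "(w, c)"] vw V by (simp add: st_def)
  have "h \<otimes> L (v, True) \<otimes> L (w, True) \<otimes> L (v, False)
      = h \<otimes> (L (v, True) \<otimes> (L (w, True) \<otimes> L (v, False)))"
    using V relator by (simp add: m_assoc)
  also have "L (w, True) \<otimes> L (v, False) = L (v, False) \<otimes> L (w, True)"
    using com by simp
  finally have 1: "h \<otimes> L (v, True) \<otimes> L (w, True) \<otimes> L (v, False) = h \<otimes> L (w, True)"
    using V relator by (simp add: L_False)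
  have 2: "h \<otimes> L (w, True) \<otimes> L (w, False) = h"
    using V relator by (simp add: L_False m_assoc)
  \<comment> \<open>Opposite edges of the square spanned by \<open>v\<close> and \<open>w\<close>
    are dual to the same walls, since \<open>w\<close> lies in \<open>lk v\<close> and
    \<open>v\<close> in \<open>lk w\<close>.\<close>
  have 3: "h \<otimes> L (w, True) \<in> K v \<longleftrightarrow> h \<in> K v" "h \<otimes> L (v, True) \<in> K w \<longleftrightarrow> h \<in> K w"
    using sub_mult_cancel_right lk_subset relator r vw by simp_all
  show ?case using vw 3 by (auto simp: r commutator_word_def 1 2)
qed auto

text \<open>The side away from \<open>\<one>\<close> of the wall between \<open>\<one>\<close> and
  the generator \<open>x\<close>.\<close>

definition hs :: "'a \<Rightarrow> 'a word set set"
  where "hs x = {g. \<exists>u\<in>words V. g = cl u \<and> wall_parity x \<one> u}"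

lemma cl_hs_iff: "u \<in> words V \<Longrightarrow> cl u \<in> hs x \<longleftrightarrow> wall_parity x \<one> u"
  unfolding hs_def using wall_parity_pres_eq[of _ _ \<one> x] cl_eq_iff by blast

lemma hs_step:
  assumes "g \<in> carrier G" "fst l \<in> V"
  shows "g \<otimes> L l \<in> hs x \<longleftrightarrow>
    (g \<in> hs x) \<noteq> (fst l = x \<and> (if snd l then g \<in> K x else g \<otimes> L l \<in> K x))"
proof -
  obtain u where u: "u \<in> words V" "g = cl u" using assms elem_cases by blast
  have "g \<otimes> L l = cl (u @ [l])" using u assms by (simp add: cl_append)
  then show ?thesis using u assms by (simp add: cl_hs_iff wall_parity_append)
qed

text \<open>Left translation by \<open>K x\<close> permutes the edges dual to the wall of
  \<open>x\<close>.\<close>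

lemma wall_parity_K_shift:
  assumes "k \<in> K x" "h \<in> carrier G" "u \<in> words V"
  shows "wall_parity x (k \<otimes> h) u \<longleftrightarrow> wall_parity x h u"
  using assms(2,3)
proof (induction u arbitrary: h)
  case (Cons l u)
  have k: "k \<in> carrier G" using assms K_carrier by blast
  show ?case using Cons k assms sub_mult_cancel_left[OF lk_subset assms(1)]
    by (simp add: m_assoc)
qed simp

lemma wall_parity_words_lk: "u \<in> words (lk x) \<Longrightarrow> \<not> wall_parity x h u"
  by (induction u arbitrary: h) auto

lemma K_notin_hs: "k \<in> K x \<Longrightarrow> k \<notin> hs x"
  unfolding sub_def using cl_hs_iff wall_parity_words_lk words_mono[OF _ lk_subset] by auto

lemma K_mult_hs_iff:
  assumes "k \<in> K x" "g \<in> carrier G"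
  shows "k \<otimes> g \<in> hs x \<longleftrightarrow> g \<in> hs x"
proof -
  obtain u where u: "u \<in> words V" "g = cl u" using elem_cases[OF assms(2)] by blast
  obtain v where "v \<in> words (lk x)" "k = cl v" using assms(1) by (auto simp: sub_def)
  note uv = u this
  then have v: "v \<in> words V" using lk_subset words_mono by blast
  then have k: "k \<in> carrier G" using uv by simp
  have "k \<otimes> g \<in> hs x \<longleftrightarrow> wall_parity x \<one> (v @ u)"
    using uv v by (simp add: cl_hs_iff flip: cl_append)
  also have "\<dots> \<longleftrightarrow> wall_parity x (k \<otimes> \<one>) u" using uv v k by (simp add: wall_parity_append wall_parity_words_lk)
  also have "\<dots> \<longleftrightarrow> g \<in> hs x" using uv assms by (subst wall_parity_K_shift) (simp_all add: cl_hs_iff)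
  finally show ?thesis .
qed

text \<open>The halfspace of the elements with a reduced expression starting with the letter \<open>s\<close>. Its
  boundary is the wall dual to the edges from \<open>k\<close> to \<open>k s\<close> for \<open>k\<close> in \<^term>\<open>K (fst s)\<close>.\<close>

definition H :: "'a \<times> bool \<Rightarrow> 'a word set set" where
  "H s = (if snd s then hs (fst s) else {g \<in> carrier G. L (fst s, True) \<otimes> g \<notin> hs (fst s)})"

text \<open>Only an edge of the wall changes sides, and its end in \<open>K x\<close> is known to
  lie outside \<open>hs x\<close>; this determines the letter and its direction. For a negative
  letter the argument is applied to the edge translated by \<open>x\<close>.\<close>

lemma H_enter:
  assumes "h \<in> carrier G" "fst l \<in> V" "fst s \<in> V" "h \<notin> H s" "h \<otimes> L l \<in> H s"
  shows "l = s" "h \<in> K (fst s)"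
proof -
  obtain x b where s: "s = (x, b)" by fastforce
  have "l = s \<and> h \<in> K (fst s)"
  proof (cases b)
    case True
    with assms s have n: "h \<notin> hs x" "h \<otimes> L l \<in> hs x" by (auto simp: H_def)
    with hs_step[of h l x] assms have e: "fst l = x" "if snd l then h \<in> K x else h \<otimes> L l \<in> K x"
      by auto
    with n K_notin_hs have "snd l" "h \<in> K x" by (auto split: if_splits)
    with e s True show ?thesis by (simp add: prod_eq_iff)
  next
    case False
    let ?g = "L (x, True) \<otimes> h"
    have g: "?g \<in> carrier G" "?g \<otimes> L l = L (x, True) \<otimes> (h \<otimes> L l)"
      using assms s by (auto simp: m_assoc)
    with False assms s have n: "?g \<in> hs x" "?g \<otimes> L l \<notin> hs x" by (auto simp: H_def)
    with hs_step[of ?g l x] assms g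
    have e: "fst l = x" "if snd l then ?g \<in> K x else ?g \<otimes> L l \<in> K x"
      by auto
    with n K_notin_hs have l: "\<not> snd l" "?g \<otimes> L l \<in> K x" by (auto split: if_splits)
    have ls: "l = s" using l e s False by (simp add: prod_eq_iff)
    \<comment> \<open>Translating back: \<open>x h = k x\<close> with \<open>k\<close> in
      \<open>K x\<close>, and \<open>k\<close> commutes with \<open>x\<close>, so
      \<open>h = k\<close>.\<close>
    obtain k where k: "k \<in> K x" "L (x, True) \<otimes> h \<otimes> inv L (x, True) = k"
      using l ls s False assms by (simp add: L_False)
    have kc: "k \<in> carrier G" using k K_carrier by blast
    have "k \<otimes> L (x, True) = L (x, True) \<otimes> k" using K_commute[of k "(x, True)"] k assms s by simp
    also have "k \<otimes> L (x, True) = L (x, True) \<otimes> h"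
      using assms s by (simp flip: k(2) add: m_assoc)
    finally have "h = k" using assms s kc by simp
    with k ls s show ?thesis by simp
  qed
  then show "l = s" "h \<in> K (fst s)" by auto
qed

lemma one_notin_hs: "\<one> \<notin> hs x"
  using K_notin_hs sub_one by blast

lemma L_in_hs: "x \<in> V \<Longrightarrow> L (x, True) \<in> hs x"
  using hs_step[of \<one> "(x, True)" x] one_notin_hs by simp

lemma K_notin_H:
  assumes "k \<in> K (fst s)" "fst s \<in> V"
  shows "k \<notin> H s"
proof (cases "snd s")
  case True
  with assms K_notin_hs show ?thesis by (simp add: H_def)
next
  case False
  have k: "k \<in> carrier G" using assms K_carrier by blast
  have "L (fst s, True) \<otimes> k = k \<otimes> L (fst s, True)"
    using K_commute[of k "(fst s, True)"] assms by simp
  then have "L (fst s, True) \<otimes> k \<in> hs (fst s)"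
    using K_mult_hs_iff[of k "fst s" "L (fst s, True)"] L_in_hs[of "fst s"] assms by simp
  with False show ?thesis by (simp add: H_def)
qed

lemma one_notin_H: "fst s \<in> V \<Longrightarrow> \<one> \<notin> H s"
  using K_notin_H sub_one by blast

text \<open>The basic ping-pong move. It is built into the choice of \<open>H\<close> for a negative
  letter as a translated complement of \<open>hs\<close>.\<close>

lemma L_mult_H_iff:
  assumes "fst s \<in> V" "h \<in> carrier G"
  shows "L s \<otimes> h \<in> H s \<longleftrightarrow> h \<notin> H (bar s)"
proof -
  obtain x b where s: "s = (x, b)" by fastforce
  show ?thesis using assms s by (cases b) (auto simp: H_def L_False)
qed

lemma K_mult_H_iff:
  assumes "k \<in> K (fst s)" "g \<in> carrier G" "fst s \<in> V"
  shows "k \<otimes> g \<in> H s \<longleftrightarrow> g \<in> H s"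
proof -
  have k: "k \<in> carrier G" using assms K_carrier by blast
  have "L (fst s, True) \<otimes> (k \<otimes> g) = k \<otimes> (L (fst s, True) \<otimes> g)"
    using K_commute[of k "(fst s, True)"] assms k by (simp flip: m_assoc)
  then show ?thesis using assms k K_mult_hs_iff by (simp add: H_def)
qed

section \<open>Paths crossing walls, and disjoint halfspaces\<close>

lemma H_carrier: "H s \<subseteq> carrier G"
  by (auto simp: H_def hs_def)

text \<open>The path \<open>u\<close> starts at \<open>g\<close>, and the halfspace is the translate
  of \<open>H s\<close> by \<open>a\<close>. At the point of entry \<open>H_enter\<close> identifies
  the letter and the position.\<close>

lemma path_enters:
  assumes "a \<in> carrier G" "g \<in> carrier G" "u \<in> words V" "fst s \<in> V"
    and "inv a \<otimes> g \<notin> H s" "inv a \<otimes> (g \<otimes> cl u) \<in> H s"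
  obtains p q where "u = p @ s # q" "inv a \<otimes> (g \<otimes> cl p) \<in> K (fst s)"
proof -
  let ?P = "\<lambda>p. p \<in> words V \<longrightarrow> inv a \<otimes> (g \<otimes> cl p) \<in> H s"
  have "\<not> ?P []" "?P u" using assms by simp_all
  then obtain p l q where u: "u = p @ l # q" and p: "\<not> ?P p" "?P (p @ [l])"
    using split_at_first_entry[of ?P u] by blast
  have w: "p \<in> words V" "fst l \<in> V" using u assms by auto
  have "inv a \<otimes> (g \<otimes> cl (p @ [l])) = inv a \<otimes> (g \<otimes> cl p) \<otimes> L l"
    using w assms by (simp add: cl_append m_assoc)
  then have "inv a \<otimes> (g \<otimes> cl p) \<otimes> L l \<in> H s" using p w by simp
  with H_enter[of "inv a \<otimes> (g \<otimes> cl p)" l s] p w assms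
  have "l = s" "inv a \<otimes> (g \<otimes> cl p) \<in> K (fst s)" by auto
  with that u show thesis by blast
qed

text \<open>Entering the halfspace would use the letter \<open>s\<close>, and leaving it is an entry
  of the reversed path; neither can happen with letters from \<open>S\<close>.\<close>

lemma H_stays:
  assumes "a \<in> carrier G" "g \<in> carrier G" "u \<in> words S" "S \<subseteq> V" "fst s \<in> V" "fst s \<notin> S"
  shows "inv a \<otimes> (g \<otimes> cl u) \<in> H s \<longleftrightarrow> inv a \<otimes> g \<in> H s"
proof -
  have no: False
    if "inv a \<otimes> g' \<notin> H s" "inv a \<otimes> (g' \<otimes> cl v) \<in> H s" "v \<in> words S" "g' \<in> carrier G" for g' v
  proof -
    have "v \<in> words V" using that assms words_mono by blast
    with path_enters[of a g' v s] that assms obtain p q where "v = p @ s # q" by blast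
    with that assms show False by simp
  qed
  have w: "u \<in> words V" using assms words_mono by blast
  have "inv (cl u) \<in> sub S" using assms sub_inv by (simp add: sub_def)
  then obtain v where v: "v \<in> words S" "inv (cl u) = cl v" by (auto simp: sub_def)
  have "g \<otimes> cl u \<otimes> cl v = g" using w assms by (simp add: m_assoc flip: v(2))
  then show ?thesis
    using no[of g u] no[of "g \<otimes> cl u" v] v assms w by (auto simp: cl_closed)
qed

text \<open>A path from \<open>a\<close> to a common point \<open>g\<close> of the two translated
  halfspaces enters their intersection along some edge, which crosses the wall of one of them into
  the other; \<open>aux\<close> excludes this. The case \<open>t = bar s\<close> is
  included.\<close>

lemma halfspaces_disjoint:
  assumes s: "fst s \<in> V" and t: "fst t \<in> V" and "t \<noteq> s" "fst t \<notin> lk (fst s)"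
    and a: "a \<in> carrier G" and b: "b \<in> carrier G" and g: "g \<in> carrier G"
    and "inv b \<otimes> a \<notin> H t" "inv a \<otimes> b \<notin> H s"
  shows "\<not> (inv a \<otimes> g \<in> H s \<and> inv b \<otimes> g \<in> H t)"
proof
  \<comment> \<open>A detour to the crossing point: a word over \<open>lk (fst s)\<close> followed
    by \<open>s\<close> leads from \<open>a\<close>, which lies outside the translate of
    \<open>H t\<close>, into that translate. It would have to contain the letter
    \<open>t\<close>.\<close>
  have aux: False
    if st: "fst s \<in> V" "fst t \<in> V" "t \<noteq> s" "fst t \<notin> lk (fst s)"
    and ab: "a \<in> carrier G" "b \<in> carrier G" "h \<in> carrier G"
    and "inv b \<otimes> a \<notin> H t" "inv a \<otimes> h \<in> K (fst s)" "inv b \<otimes> (h \<otimes> L s) \<in> H t"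
    for s t a b h
  proof -
    have "inv a \<otimes> h \<in> sub (lk (fst s))" by fact
    then obtain k where k: "k \<in> words (lk (fst s))" "inv a \<otimes> h = cl k" by (auto simp: sub_def)
    have kV: "k \<in> words V" using k lk_subset words_mono by blast
    have "h = a \<otimes> cl k" using ab by (simp flip: k(2))
    then have "inv b \<otimes> (a \<otimes> cl (k @ [s])) \<in> H t"
      using that kV by (simp add: cl_append m_assoc)
    with path_enters[of b a "k @ [s]" t] that kV
    obtain p q where "k @ [s] = p @ t # q" by (metis words_simps(1,2,3) m_closed inv_closed)
    then have "t \<in> set k \<or> t = s" by (metis in_set_conv_decomp set_ConsD set_append Un_iff empty_iff list.set(1))
    with k st show False by (auto simp: words_def)
  qed
  assume "inv a \<otimes> g \<in> H s \<and> inv b \<otimes> g \<in> H t"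
  let ?P = "\<lambda>p. p \<in> words V \<longrightarrow> inv a \<otimes> (a \<otimes> cl p) \<in> H s \<and> inv b \<otimes> (a \<otimes> cl p) \<in> H t"
  obtain u where u: "u \<in> words V" "inv a \<otimes> g = cl u"
    using a g elem_cases[of "inv a \<otimes> g"] by auto
  have "a \<otimes> cl u = g" using a g by (simp flip: u(2))
  then have "?P u" using \<open>inv a \<otimes> g \<in> H s \<and> inv b \<otimes> g \<in> H t\<close> by simp
  moreover have "\<not> ?P []" using assms one_notin_H by simp
  ultimately obtain p l q where pq: "u = p @ l # q" and p: "\<not> ?P p" "?P (p @ [l])"
    using split_at_first_entry[of ?P u] by blast
  let ?h = "a \<otimes> cl p"
  have w: "p \<in> words V" "fst l \<in> V" "?h \<in> carrier G" using pq u a by auto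
  have eq: "a \<otimes> cl (p @ [l]) = ?h \<otimes> L l"
    using w a by (simp add: cl_append m_assoc)
  have in2: "inv a \<otimes> (?h \<otimes> L l) \<in> H s" "inv b \<otimes> (?h \<otimes> L l) \<in> H t"
    using p w unfolding eq by auto
  have eqs: "inv c \<otimes> (?h \<otimes> L l) = inv c \<otimes> ?h \<otimes> L l" if "c \<in> carrier G" for c
    using that w by (simp add: m_assoc)
  consider "inv a \<otimes> ?h \<notin> H s" | "inv b \<otimes> ?h \<notin> H t" using p w by auto
  then show False
  proof cases
    case 1
    with H_enter[of "inv a \<otimes> ?h" l s] in2 eqs[OF a] w a s
    have "l = s" "inv a \<otimes> ?h \<in> K (fst s)" by auto
    with aux[of s t a b ?h] in2 w assms show False by simp
  next
    case 2
    with H_enter[of "inv b \<otimes> ?h" l t] in2 eqs[OF b] w b t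
    have "l = t" "inv b \<otimes> ?h \<in> K (fst t)" by auto
    with aux[of t s b a ?h] in2 w assms lk_sym show False by metis
  qed
qed

lemma H_bar_disjoint:
  assumes "fst s \<in> V" "g \<in> H s"
  shows "g \<notin> H (bar s)"
proof -
  have "g \<in> carrier G" using assms H_carrier by blast
  with halfspaces_disjoint[of s "bar s" \<one> \<one> g] assms one_notin_H[of s] one_notin_H[of "bar s"]
  show ?thesis by simp
qed

section \<open>Lengths and centralizers of generators\<close>

definition len :: "'a word set \<Rightarrow> nat"
  where "len g = (LEAST n. \<exists>u\<in>words V. cl u = g \<and> length u = n)"

lemma len_le: "u \<in> words V \<Longrightarrow> len (cl u) \<le> length u"
  unfolding len_def by (rule Least_le) blast

lemma len_witness:
  assumes "g \<in> carrier G"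
  obtains u where "u \<in> words V" "g = cl u" "length u = len g"
proof -
  have "\<exists>n. \<exists>u\<in>words V. cl u = g \<and> length u = n" using assms elem_cases by metis
  then have "\<exists>u\<in>words V. cl u = g \<and> length u = len g" unfolding len_def by (rule LeastI_ex)
  with that show thesis by blast
qed

lemma inv_cl: "u \<in> words V \<Longrightarrow> inv (cl u) = cl (rev (map bar u)) \<and> rev (map bar u) \<in> words V"
proof (induction u)
  case (Cons l u)
  then show ?case using cl_Cons[of l u] by (simp add: inv_mult_group L_bar cl_append)
qed simp

lemma len_inv_le: "g \<in> carrier G \<Longrightarrow> len (inv g) \<le> len g"
  by (metis len_witness inv_cl len_le length_map length_rev)

lemma len_inv [simp]: "g \<in> carrier G \<Longrightarrow> len (inv g) = len g"
  using len_inv_le[of g] len_inv_le[of "inv g"] by simp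

text \<open>The translated wall separates \<open>\<one>\<close> from \<open>g\<close>, so a shortest
  word for \<open>g\<close> has the form \<open>p @ s # q\<close> with the crossing at
  \<open>s\<close>. Multiplication by the conjugate of \<open>L (bar s)\<close> by \<open>a\<close>
  deletes this \<open>s\<close>, because \<open>inv a \<otimes> cl p\<close> commutes with
  it.\<close>

lemma len_shorten:
  assumes "a \<in> carrier G" "g \<in> carrier G" "fst s \<in> V" "inv a \<notin> H s" "inv a \<otimes> g \<in> H s"
  shows "len (a \<otimes> L (bar s) \<otimes> inv a \<otimes> g) < len g"
proof -
  obtain u where u: "u \<in> words V" "g = cl u" "length u = len g" using assms len_witness by blast
  obtain p q where pq: "u = p @ s # q" "inv a \<otimes> (\<one> \<otimes> cl p) \<in> K (fst s)"
    using path_enters[of a \<one> u s] assms u by auto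
  have w: "p \<in> words V" "q \<in> words V" using u pq by auto
  let ?k = "inv a \<otimes> cl p"
  have k: "?k \<otimes> L s = L s \<otimes> ?k" using K_commute pq w assms by simp
  have "a \<otimes> L (bar s) \<otimes> inv a \<otimes> g = a \<otimes> inv (L s) \<otimes> (?k \<otimes> L s) \<otimes> cl q"
    using u w assms cl_Cons[of s q] by (simp add: pq cl_append m_assoc L_bar)
  also have "\<dots> = cl (p @ q)" unfolding k using w assms by (simp add: cl_append m_assoc)
  finally have "len (a \<otimes> L (bar s) \<otimes> inv a \<otimes> g) \<le> length (p @ q)"
    using len_le[of "p @ q"] w by simp
  also have "\<dots> < len g" by (simp flip: u(3) add: pq)
  finally show ?thesis .
qed

lemma len_shorten_one:
  assumes "g \<in> H s" "fst s \<in> V"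
  shows "len (L (bar s) \<otimes> g) < len g"
proof -
  have "g \<in> carrier G" using assms H_carrier by blast
  then show ?thesis using len_shorten[of \<one> g s] assms one_notin_H by simp
qed

lemma first_letter:
  assumes "g \<in> carrier G" "g \<noteq> \<one>"
  obtains t g' where "fst t \<in> V" "g' \<in> carrier G" "g = L t \<otimes> g'" "len g' < len g"
    "g \<in> H t" "g' \<notin> H (bar t)"
proof -
  obtain u where u: "u \<in> words V" "g = cl u" "length u = len g" using assms len_witness by blast
  with assms obtain t u' where t: "u = t # u'" by (cases u) auto
  have *: "fst t \<in> V" "cl u' \<in> carrier G" "g = L t \<otimes> cl u'"
    using u t cl_Cons[of t u'] by auto
  have l: "len (cl u') < len g" using u t len_le[of u'] by auto
  \<comment> \<open>Otherwise \<open>len_shorten_one\<close> would make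
    \<open>g = L t \<otimes> cl u'\<close> shorter than \<open>cl u'\<close>, contrary to
    \<open>l\<close>.\<close>
  have n: "cl u' \<notin> H (bar t)" using len_shorten_one[of "cl u'" "bar t"] * l by auto
  then have "g \<in> H t" using * L_mult_H_iff by simp
  with that * l n show thesis by blast
qed

text \<open>A final letter \<open>x\<close> of \<open>g\<close> is split off by induction. Without
  one, \<open>inv g\<close> lies outside both halfspaces of \<open>x\<close>, while
  \<open>inv g \<otimes> L (x, True)\<close>, being \<open>L (x, True) \<otimes> inv g\<close>, lies
  in one of them. The edge between the two crosses the wall, which places \<open>inv g\<close> in
  \<open>K x\<close>.\<close>

lemma centralizer_gen:
  assumes "g \<in> carrier G" "x \<in> V" "g \<otimes> L (x, True) = L (x, True) \<otimes> g"
  shows "g \<in> sub (st x)"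
  using assms
proof (induction "len g" arbitrary: g rule: less_induct)
  case less
  show ?case
  proof (cases "\<exists>b. inv g \<in> H (x, b)")
    case True
    then obtain b where b: "inv g \<in> H (x, b)" by blast
    let ?s = "(x, b)" and ?h = "g \<otimes> L (x, b)"
    have inv_h: "inv ?h = L (bar ?s) \<otimes> inv g"
      using less L_bar[of ?s] by (simp add: inv_mult_group)
    have h: "?h \<in> carrier G" using less by simp
    have "len (inv ?h) < len (inv g)" using len_shorten_one[OF b] less by (simp add: inv_h)
    then have "len ?h < len g" using h less by simp
    moreover have "?h \<otimes> L (x, True) = L (x, True) \<otimes> ?h"
      using less L_commute[of ?s "(x, True)"] by (simp add: commute_mult)
    ultimately have "?h \<in> sub (st x)" using less.hyps[OF _ h] less.prems by blast
    then show ?thesis using sub_mult_cancel_right[of "st x" "L ?s" g] less st_subset by simp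
  next
    case False
    let ?s = "(x, True)"
    have "inv g \<otimes> L ?s = L ?s \<otimes> inv g" using commute_inv less by simp
    then have "inv g \<otimes> (\<one> \<otimes> cl [?s]) \<in> H ?s"
      using L_mult_H_iff[of ?s "inv g"] False less by simp
    then obtain p q where pq: "[?s] = p @ ?s # q" "inv g \<otimes> (\<one> \<otimes> cl p) \<in> K (fst ?s)"
      using path_enters[of g \<one> "[?s]" ?s] False less by auto
    then have "p = []" by (cases p) auto
    with pq less have "inv g \<in> K x" by simp
    then have "inv (inv g) \<in> K x" using sub_inv lk_subset by blast
    then show ?thesis using less K_sub_st by auto
  qed
qed

text \<open>As in \<open>centralizer_gen\<close>, final letters \<open>y\<close> of \<open>g\<close>
  are split off first. Then \<open>inv g\<close> and \<open>L (y, True) \<otimes> inv g\<close> are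
  on different sides of a wall of \<open>y\<close>. By \<open>centralizer_gen\<close> they are
  joined by a path with letters in \<open>st x\<close>; its initial part up to the wall gives
  \<open>k\<close>.\<close>

lemma commuting_conjugates:
  assumes "g \<in> carrier G" "x \<in> V" "y \<in> V"
    and "(g \<otimes> L (y, True) \<otimes> inv g) \<otimes> L (x, True) = L (x, True) \<otimes> (g \<otimes> L (y, True) \<otimes> inv g)"
  shows "\<exists>k\<in>sub (st x). \<exists>k'\<in>sub (st y). g = k \<otimes> k'"
  using assms
proof (induction "len g" arbitrary: g rule: less_induct)
  case less
  show ?case
  proof (cases "\<exists>b. inv g \<in> H (y, b)")
    case True
    then obtain b where b: "inv g \<in> H (y, b)" by blast
    let ?s = "(y, b)" and ?h = "g \<otimes> L (y, b)"
    have inv_h: "inv ?h = L (bar ?s) \<otimes> inv g"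
      using less L_bar[of ?s] by (simp add: inv_mult_group)
    have h: "?h \<in> carrier G" using less by simp
    have "len (inv ?h) < len (inv g)" using len_shorten_one[OF b] less by (simp add: inv_h)
    then have "len ?h < len g" using h less by simp
    moreover have "?h \<otimes> L (y, True) \<otimes> inv ?h = g \<otimes> L (y, True) \<otimes> inv g"
    proof -
      have "?h \<otimes> L (y, True) \<otimes> inv ?h = g \<otimes> (L ?s \<otimes> L (y, True)) \<otimes> (inv (L ?s) \<otimes> inv g)"
        using less by (simp add: m_assoc inv_mult_group)
      also have "L ?s \<otimes> L (y, True) = L (y, True) \<otimes> L ?s"
        using L_commute[of ?s "(y, True)"] less by simp
      finally show ?thesis using less by (simp add: m_assoc)
    qed
    ultimately obtain k k' where k: "k \<in> sub (st x)" "k' \<in> sub (st y)" "?h = k \<otimes> k'"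
      using less.hyps[OF _ h less.prems(2,3)] less.prems(4) by auto
    have c: "k \<in> carrier G" "k' \<in> carrier G" using k sub_carrier st_subset less.prems by blast+
    have "g = ?h \<otimes> L (bar ?s)" using less L_bar[of ?s] by (simp add: m_assoc)
    then have "g = k \<otimes> (k' \<otimes> L (bar ?s))" using k c less by (simp add: m_assoc)
    moreover have "k' \<otimes> L (bar ?s) \<in> sub (st y)" using k sub_mult st_subset less by simp
    ultimately show ?thesis using k by blast
  next
    case False
    let ?s = "(y, True)" and ?T = "g \<otimes> L (y, True) \<otimes> inv g"
    have "?T \<in> sub (st x)" using centralizer_gen less by simp
    then obtain u where u: "u \<in> words (st x)" "?T = cl u" by (auto simp: sub_def)
    have uV: "u \<in> words V" using words_mono[OF u(1) st_subset] less.prems by simp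
    have "inv g \<otimes> ?T = L ?s \<otimes> inv g" using less by (simp add: m_assoc)
    then have "inv g \<otimes> (\<one> \<otimes> cl u) \<in> H ?s"
      using L_mult_H_iff[of ?s "inv g"] False less uV by (simp flip: u(2))
    then obtain p q where pq: "u = p @ ?s # q" "inv g \<otimes> (\<one> \<otimes> cl p) \<in> K (fst ?s)"
      using path_enters[of g \<one> u ?s] False less uV by auto
    have p: "p \<in> words V" "cl p \<in> sub (st x)" using pq u uV by (auto simp: sub_def)
    let ?k = "inv g \<otimes> cl p"
    have "?k \<in> sub (st y)" using pq p K_sub_st by auto
    then have "inv ?k \<in> sub (st y)" using sub_inv st_subset less.prems by blast
    moreover have "g = cl p \<otimes> inv ?k" using less p by (simp add: inv_mult_group m_assoc)
    ultimately show ?thesis using p by blast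
  qed
qed

text \<open>The letter \<open>x\<close> commutes with \<open>K x\<close>, and all other letters of
  \<open>st x\<close> lie in \<open>K x\<close>.\<close>

lemma conj_lk_in_K:
  assumes "x \<in> V" "k \<in> sub (st x)" "fst t \<in> lk x"
  shows "k \<otimes> L t \<otimes> inv k \<in> K x"
proof -
  have t: "fst t \<in> V" using assms lk_V by blast
  have "cl u \<otimes> L t \<otimes> inv (cl u) \<in> K x" if "u \<in> words (st x)" for u
    using that
  proof (induction u)
    case Nil
    then show ?case using assms t by simp
  next
    case (Cons l u)
    then have V: "fst l \<in> V" "u \<in> words V"
      using st_subset[OF assms(1)] words_mono[OF _ st_subset[OF assms(1)]] by auto
    let ?c = "cl u \<otimes> L t \<otimes> inv (cl u)"
    have c: "?c \<in> K x" using Cons by simp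
    have eq: "cl (l # u) \<otimes> L t \<otimes> inv (cl (l # u)) = L l \<otimes> ?c \<otimes> inv (L l)"
      using V t cl_Cons[OF V] by (simp add: inv_mult_group m_assoc)
    show ?case
    proof (cases "fst l = x")
      case True
      then have "L l \<otimes> ?c = ?c \<otimes> L l" using K_commute[of ?c l] c V by simp
      then have "L l \<otimes> ?c \<otimes> inv (L l) = ?c" using V t by (simp add: m_assoc)
      with c eq show ?thesis by simp
    next
      case False
      then have "L l \<in> K x" using Cons by (auto simp: st_def)
      then show ?thesis unfolding eq using c sub_mult sub_inv lk_subset by simp
    qed
  qed
  with assms show ?thesis by (auto simp: sub_def)
qed

end

section \<open>Ping-pong for conjugating endomorphisms\<close>

text \<open>A conjugating endomorphism together with conjugators that cannot be shortened within their
  cosets modulo the centralizers of the generators.\<close>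

locale conjugating = raag +
  fixes \<phi> :: "'a word set \<Rightarrow> 'a word set" and w :: "'a \<Rightarrow> 'a word set"
  assumes \<phi>_hom: "\<phi> \<in> hom G G"
    and w_closed: "x \<in> V \<Longrightarrow> w x \<in> carrier G"
    and \<phi>_gen: "x \<in> V \<Longrightarrow> \<phi> (L (x, True)) = w x \<otimes> L (x, True) \<otimes> inv (w x)"
    and w_min: "x \<in> V \<Longrightarrow> inv (w x) \<notin> H (x, b)"
begin

lemma \<phi>_group_hom: "group_hom G G \<phi>"
  using \<phi>_hom by unfold_locales

lemma \<phi>_L:
  assumes "fst s \<in> V"
  shows "\<phi> (L s) = w (fst s) \<otimes> L s \<otimes> inv (w (fst s))"
proof -
  interpret \<phi>: group_hom G G \<phi> by (rule \<phi>_group_hom)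
  obtain x b where s: "s = (x, b)" by fastforce
  show ?thesis
    using assms \<phi>_gen[of x] w_closed[of x]
    by (cases b) (simp_all add: s L_False inv_mult_group m_assoc)
qed

text \<open>The translate of \<open>H s\<close> by the conjugator. It plays for
  \<open>\<phi> (L s)\<close> the role that \<open>H s\<close> plays for \<open>L s\<close>.\<close>

definition M :: "'a \<times> bool \<Rightarrow> 'a word set \<Rightarrow> bool"
  where "M s g \<longleftrightarrow> inv (w (fst s)) \<otimes> g \<in> H s"

lemma M_one: "fst s \<in> V \<Longrightarrow> \<not> M s \<one>"
  using w_min[of "fst s" "snd s"] w_closed by (simp add: M_def)

lemma M_mult_iff:
  assumes "fst s \<in> V" "g \<in> carrier G"
  shows "M s (\<phi> (L s) \<otimes> g) \<longleftrightarrow> \<not> M (bar s) g"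
proof -
  have "inv (w (fst s)) \<otimes> (\<phi> (L s) \<otimes> g) = L s \<otimes> (inv (w (fst s)) \<otimes> g)"
    using assms w_closed by (simp add: \<phi>_L m_assoc)
  then show ?thesis using L_mult_H_iff[of s "inv (w (fst s)) \<otimes> g"] assms w_closed
    by (simp add: M_def)
qed

lemma M_bar: "fst s \<in> V \<Longrightarrow> M s g \<Longrightarrow> \<not> M (bar s) g"
  using H_bar_disjoint unfolding M_def by simp

text \<open>Adjacent generators have commuting images; conjugating both by \<open>inv (w x)\<close>
  reduces this to \<open>commuting_conjugates\<close>.\<close>

lemma w_adjacent:
  assumes "y \<in> lk x"
  shows "\<exists>k\<in>sub (st x). \<exists>k'\<in>sub (st y). inv (w x) \<otimes> w y = k \<otimes> k'"
proof -
  interpret \<phi>: group_hom G G \<phi> by (rule \<phi>_group_hom)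
  have V: "x \<in> V" "y \<in> V" using assms lk_V by auto
  let ?x = "L (x, True)" and ?y = "L (y, True)" and ?g = "inv (w x) \<otimes> w y"
  have W: "w x \<in> carrier G" "w y \<in> carrier G" using V w_closed by auto
  have "?y \<otimes> ?x = ?x \<otimes> ?y" using gen_commute[OF assms] by simp
  then have "\<phi> ?y \<otimes> \<phi> ?x = \<phi> ?x \<otimes> \<phi> ?y" using V by (metis \<phi>.hom_mult cl_closed fst_conv words_simps(1,2))
  then have "inv (w x) \<otimes> (\<phi> ?y \<otimes> \<phi> ?x) \<otimes> w x = inv (w x) \<otimes> (\<phi> ?x \<otimes> \<phi> ?y) \<otimes> w x" by simp
  then have "(?g \<otimes> ?y \<otimes> inv ?g) \<otimes> ?x = ?x \<otimes> (?g \<otimes> ?y \<otimes> inv ?g)"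
    using V W by (simp add: \<phi>_L inv_mult_group m_assoc)
  then show ?thesis using commuting_conjugates V W by simp
qed

text \<open>By \<open>w_adjacent\<close>, the conjugate of \<open>\<phi> (L t)\<close> by
  \<open>inv (w (fst s))\<close> equals that of \<open>L t\<close> by an element of the star
  subgroup. It lies in \<open>K (fst s)\<close>, which stabilizes \<open>H s\<close>.\<close>

lemma M_adjacent:
  assumes "fst t \<in> lk (fst s)" "g \<in> carrier G"
  shows "M s (\<phi> (L t) \<otimes> g) \<longleftrightarrow> M s g"
proof -
  let ?x = "fst s" and ?y = "fst t"
  have V: "?x \<in> V" "?y \<in> V" using assms lk_V by auto
  have W: "w ?x \<in> carrier G" "w ?y \<in> carrier G" using V w_closed by auto
  obtain k k' where k: "k \<in> sub (st ?x)" "k' \<in> sub (st ?y)" "inv (w ?x) \<otimes> w ?y = k \<otimes> k'"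
    using w_adjacent[OF assms(1)] by blast
  have c: "k \<in> carrier G" "k' \<in> carrier G" using k V sub_carrier st_subset by blast+
  have "inv (w ?x) \<otimes> (\<phi> (L t) \<otimes> g)
      = (inv (w ?x) \<otimes> w ?y) \<otimes> L t \<otimes> inv (inv (w ?x) \<otimes> w ?y) \<otimes> (inv (w ?x) \<otimes> g)"
    using V W assms by (simp add: \<phi>_L inv_mult_group m_assoc)
  also have "\<dots> = k \<otimes> (k' \<otimes> L t) \<otimes> inv k' \<otimes> inv k \<otimes> (inv (w ?x) \<otimes> g)"
    unfolding k(3) using V W assms c by (simp add: inv_mult_group m_assoc)
  also have "k' \<otimes> L t = L t \<otimes> k'" using sub_commute k V by blast
  also have "k \<otimes> (L t \<otimes> k') \<otimes> inv k' \<otimes> inv k \<otimes> (inv (w ?x) \<otimes> g)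
      = (k \<otimes> L t \<otimes> inv k) \<otimes> (inv (w ?x) \<otimes> g)"
    using V W assms c by (simp add: m_assoc)
  finally show ?thesis
    using K_mult_H_iff[of "k \<otimes> L t \<otimes> inv k" s "inv (w ?x) \<otimes> g"] conj_lk_in_K[OF V(1) k(1) assms(1)]
      V W assms by (simp add: M_def)
qed

text \<open>The points \<open>w y\<close> and \<open>w y'\<close> are joined by a path with letters
  in \<open>st y\<close> and \<open>st y'\<close>. Neither star contains \<open>fst s\<close>, so
  the path does not change sides. This allows \<open>reduce\<close> to treat a whole component at
  once.\<close>

lemma halfspace_spreads:
  assumes "fst s \<in> V" "y \<in> V" "y' \<in> lk y" "y \<notin> st (fst s)" "y' \<notin> st (fst s)"
    and "inv (w (fst s)) \<otimes> w y \<in> H s"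
  shows "inv (w (fst s)) \<otimes> w y' \<in> H s"
proof -
  let ?x = "fst s"
  have y': "y' \<in> V" using assms lk_V by blast
  have W: "w ?x \<in> carrier G" "w y \<in> carrier G" "w y' \<in> carrier G" using assms y' w_closed by auto
  obtain k k' where k: "k \<in> sub (st y)" "k' \<in> sub (st y')" "inv (w y) \<otimes> w y' = k \<otimes> k'"
    using w_adjacent[OF assms(3)] by blast
  obtain u u' where u: "u \<in> words (st y)" "k = cl u" "u' \<in> words (st y')" "k' = cl u'"
    using k by (auto simp: sub_def)
  have c: "cl u \<in> carrier G" "cl u' \<in> carrier G"
    using k u sub_carrier st_subset assms y' by blast+
  have x: "?x \<notin> st y" "?x \<notin> st y'" using assms st_sym by blast+
  have "w y' = w y \<otimes> cl u \<otimes> cl u'"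
    using W c u k(3) by (metis inv_mult_cancel(2) m_assoc)
  moreover have "inv (w ?x) \<otimes> (w y \<otimes> cl u \<otimes> cl u') \<in> H s"
    using H_stays[of "w ?x" "w y \<otimes> cl u" u' "st y'" s] H_stays[of "w ?x" "w y" u "st y" s]
      W c u x assms y' st_subset by simp
  ultimately show ?thesis by simp
qed

end

text \<open>The end of the descent in \<open>reduce\<close>: a surjective \<open>\<phi>\<close> of
  this kind fixes all generators, by \<open>fixes_gen\<close>.\<close>

locale irreducible_conjugating = conjugating +
  assumes irreducible: "x \<in> V \<Longrightarrow> y \<in> V \<Longrightarrow> y \<notin> st x \<Longrightarrow> inv (w x) \<otimes> w y \<notin> H (x, b)"
begin

lemma M_disjoint:
  assumes "fst s \<in> V" "fst t \<in> V" "fst t \<notin> st (fst s)" "g \<in> carrier G"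
  shows "\<not> (M s g \<and> M t g)"
  unfolding M_def
proof (rule halfspaces_disjoint)
  show "inv (w (fst t)) \<otimes> w (fst s) \<notin> H t"
    using irreducible[of "fst t" "fst s" "snd t"] assms st_sym by auto
  show "inv (w (fst s)) \<otimes> w (fst t) \<notin> H s"
    using irreducible[of "fst s" "fst t" "snd s"] assms by auto
qed (use assms w_closed in \<open>auto simp: st_def\<close>)

text \<open>Let \<open>t\<close> be the first letter of a shortest word for \<open>g\<close>, so
  that \<open>g\<close> lies in \<open>H t\<close> and \<open>\<phi> g\<close> in the corresponding
  translate. If \<open>s\<close> is \<open>bar t\<close> or not in the star of \<open>t\<close>,
  disjointness makes both sides false. If \<open>s\<close> and \<open>t\<close> are adjacent,
  removing \<open>t\<close> changes neither side and the claim passes to the shorter tail.\<close>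

lemma ping_pong:
  assumes "g \<in> carrier G" "fst s \<in> V"
  shows "g \<in> H s \<longleftrightarrow> M s (\<phi> g)"
  using assms
proof (induction "len g" arbitrary: g s rule: less_induct)
  case less
  interpret \<phi>: group_hom G G \<phi> by (rule \<phi>_group_hom)
  show ?case
  proof (cases "g = \<one>")
    case True
    then show ?thesis using M_one one_notin_H less by simp
  next
    case False
    then obtain t g' where t: "fst t \<in> V" "g' \<in> carrier G" "g = L t \<otimes> g'" "len g' < len g"
      "g \<in> H t" "g' \<notin> H (bar t)" using first_letter less by metis
    have \<phi>g: "\<phi> g = \<phi> (L t) \<otimes> \<phi> g'" using t by simp
    have Mt: "M t (\<phi> g)" unfolding \<phi>g using M_mult_iff less.hyps[of g' "bar t"] t by simp
    consider "s = t" | "s = bar t" | "fst t \<notin> st (fst s)" | "fst t \<in> lk (fst s)"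
      by (cases s; cases t) (auto simp: st_def)
    then show ?thesis
    proof cases
      case 1
      with t Mt show ?thesis by simp
    next
      case 2
      with t Mt M_bar H_bar_disjoint show ?thesis by blast
    next
      case 3
      have "g \<notin> H s"
        using halfspaces_disjoint[of s t \<one> \<one> g] 3 t less.prems one_notin_H
        by (auto simp: st_def)
      moreover have "\<not> M s (\<phi> g)" using M_disjoint[of s t "\<phi> g"] 3 t Mt less.prems by simp
      ultimately show ?thesis by simp
    next
      case 4
      have "g \<in> H s \<longleftrightarrow> g' \<in> H s" using K_mult_H_iff[of "L t" s g'] 4 t less.prems by simp
      also have "\<dots> \<longleftrightarrow> M s (\<phi> g')" using less t by blast
      also have "\<dots> \<longleftrightarrow> M s (\<phi> g)" unfolding \<phi>g using M_adjacent[OF 4] t by simp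
      finally show ?thesis .
    qed
  qed
qed

text \<open>The edge from \<open>1\<close> to \<open>v\<close> enters the halfspace of the first letter of a preimage of \<open>v\<close>; the wall
  that it crosses determines that letter and places \<^term>\<open>w v\<close> in \<^term>\<open>K v\<close>.\<close>

lemma fixes_gen:
  assumes "\<phi> ` carrier G = carrier G" "v \<in> V"
  shows "\<phi> (L (v, True)) = L (v, True)"
proof -
  interpret \<phi>: group_hom G G \<phi> by (rule \<phi>_group_hom)
  have "L (v, True) \<in> carrier G" using assms by simp
  then obtain g where g: "g \<in> carrier G" "\<phi> g = L (v, True)" using assms(1) by (metis imageE)
  have "L (v, True) \<notin> sub {}" using L_notin_sub[of "{}"] assms by simp
  then have "g \<noteq> \<one>" using g by (metis \<phi>.hom_one sub_one)
  then obtain t where t: "fst t \<in> V" "g \<in> H t" using first_letter g by metis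
  then have "M t (L (v, True))" using ping_pong g by metis
  moreover have "\<not> M t \<one>" using M_one t by blast
  ultimately obtain p q where pq: "[(v, True)] = p @ t # q"
      "inv (w (fst t)) \<otimes> (\<one> \<otimes> cl p) \<in> K (fst t)"
    using path_enters[of "w (fst t)" \<one> "[(v, True)]" t] t assms w_closed by (auto simp: M_def)
  then have "p = []" "t = (v, True)" by (cases p; simp)+
  with pq assms w_closed have "inv (w v) \<in> K v" by simp
  then have "inv (inv (w v)) \<in> K v" using sub_inv lk_subset by blast
  then have "w v \<otimes> L (v, True) = L (v, True) \<otimes> w v"
    using K_commute[of "w v" "(v, True)"] assms w_closed by simp
  with assms have "\<phi> (L (v, True)) = L (v, True) \<otimes> w v \<otimes> inv (w v)" by (simp add: \<phi>_gen)
  then show ?thesis using assms w_closed by (simp add: m_assoc)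
qed

end

section \<open>Partial conjugations generate\<close>

context raag
begin

abbreviation conj_gen where "conj_gen g v \<equiv> g \<otimes> L (v, True) \<otimes> inv g"

section \<open>The group \<open>PAut \<Gamma>\<close>\<close>

lemma PAut_carrier_iff:
  "\<phi> \<in> carrier (PAut \<Gamma>) \<longleftrightarrow> \<phi> \<in> hom G G \<and> \<phi> \<in> extensional (carrier G) \<and>
    bij_betw \<phi> (carrier G) (carrier G) \<and>
    (\<forall>v\<in>V. \<exists>g\<in>carrier G. \<phi> (L (v, True)) = conj_gen g v)"
  by (auto simp: PAut_def auto_def Bij_def raag_gen_eq simp flip: G_def)

lemma PAut_Bij: "\<phi> \<in> carrier (PAut \<Gamma>) \<Longrightarrow> \<phi> \<in> Bij (carrier G)"
  by (simp add: PAut_carrier_iff Bij_def)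

lemma PAut_conj_gen:
  "\<phi> \<in> carrier (PAut \<Gamma>) \<Longrightarrow> v \<in> V \<Longrightarrow> \<exists>g\<in>carrier G. \<phi> (L (v, True)) = conj_gen g v"
  by (simp add: PAut_carrier_iff)

lemma PAut_mult:
  "\<phi> \<in> carrier (PAut \<Gamma>) \<Longrightarrow> \<psi> \<in> carrier (PAut \<Gamma>) \<Longrightarrow>
    \<phi> \<otimes>\<^bsub>PAut \<Gamma>\<^esub> \<psi> = compose (carrier G) \<phi> \<psi>"
  by (simp add: PAut_def AutoGroup_def BijGroup_def flip: G_def)
    (auto simp: auto_def)

lemma PAut_one: "\<one>\<^bsub>PAut \<Gamma>\<^esub> = (\<lambda>g\<in>carrier G. g)"
  by (simp add: PAut_def AutoGroup_def BijGroup_def flip: G_def)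

lemma PAut_apply:
  "\<phi> \<in> carrier (PAut \<Gamma>) \<Longrightarrow> \<psi> \<in> carrier (PAut \<Gamma>) \<Longrightarrow> g \<in> carrier G \<Longrightarrow>
    (\<phi> \<otimes>\<^bsub>PAut \<Gamma>\<^esub> \<psi>) g = \<phi> (\<psi> g)"
  by (simp add: PAut_mult compose_def)

lemma PAut_group_hom: "\<phi> \<in> carrier (PAut \<Gamma>) \<Longrightarrow> group_hom G G \<phi>"
  by unfold_locales (simp add: PAut_carrier_iff)

lemma PAut_closed: "\<phi> \<in> carrier (PAut \<Gamma>) \<Longrightarrow> g \<in> carrier G \<Longrightarrow> \<phi> g \<in> carrier G"
  by (rule group_hom.hom_closed[OF PAut_group_hom])

lemma PAut_eqI:
  assumes "\<phi> \<in> carrier (PAut \<Gamma>)" "\<psi> \<in> carrier (PAut \<Gamma>)"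
    and "\<And>v. v \<in> V \<Longrightarrow> \<phi> (L (v, True)) = \<psi> (L (v, True))"
  shows "\<phi> = \<psi>"
  using assms hom_eqI[OF is_group] by (intro extensionalityI[of _ "carrier G"]) (auto simp: PAut_carrier_iff)

lemma group_PAut: "group (PAut \<Gamma>)"
proof -
  have "subgroup (carrier (PAut \<Gamma>)) (BijGroup (carrier G))"
  proof
    show "carrier (PAut \<Gamma>) \<subseteq> carrier (BijGroup (carrier G))"
      using PAut_Bij by (auto simp: BijGroup_def)
  next
    fix \<phi> \<psi> assume *: "\<phi> \<in> carrier (PAut \<Gamma>)" "\<psi> \<in> carrier (PAut \<Gamma>)"
    interpret \<phi>: group_hom G G \<phi> by (rule PAut_group_hom) fact
    have "compose (carrier G) \<phi> \<psi> \<in> hom G G \<inter> Bij (carrier G)"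
      using * PAut_Bij by (auto simp: PAut_carrier_iff intro: hom_compose compose_Bij)
    moreover have "\<exists>g\<in>carrier G. compose (carrier G) \<phi> \<psi> (L (v, True)) = conj_gen g v"
      if v: "v \<in> V" for v
    proof -
      obtain g h where gh: "g \<in> carrier G" "\<phi> (L (v, True)) = conj_gen g v"
        "h \<in> carrier G" "\<psi> (L (v, True)) = conj_gen h v"
        using PAut_conj_gen[OF _ v] * by meson
      then have "compose (carrier G) \<phi> \<psi> (L (v, True)) = conj_gen (\<phi> h \<otimes> g) v"
        using v by (simp add: compose_def inv_mult_group m_assoc)
      moreover have "\<phi> h \<otimes> g \<in> carrier G" using gh by simp
      ultimately show ?thesis by blast
    qed
    ultimately show "\<phi> \<otimes>\<^bsub>BijGroup (carrier G)\<^esub> \<psi> \<in> carrier (PAut \<Gamma>)"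
      using * PAut_Bij by (simp add: BijGroup_def PAut_carrier_iff Bij_def)
  next
    have "\<exists>g\<in>carrier G. (\<lambda>g\<in>carrier G. g) (L (v, True)) = conj_gen g v" if "v \<in> V" for v
      using that by (intro bexI[of _ \<one>]) simp_all
    with id_in_auto show "\<one>\<^bsub>BijGroup (carrier G)\<^esub> \<in> carrier (PAut \<Gamma>)"
      by (simp add: BijGroup_def PAut_carrier_iff auto_def Bij_def)
  next
    fix \<phi> assume *: "\<phi> \<in> carrier (PAut \<Gamma>)"
    let ?\<psi> = "restrict (inv_into (carrier G) \<phi>) (carrier G)"
    have \<psi>: "?\<psi> \<in> hom G G" "?\<psi> \<in> Bij (carrier G)"
      using * PAut_Bij[OF *] restrict_inv_into_hom restrict_inv_into_Bij
      by (auto simp: PAut_carrier_iff simp del: restrict_apply)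
    interpret \<psi>: group_hom G G ?\<psi> using \<psi> by unfold_locales
    interpret \<phi>: group_hom G G \<phi> by (rule PAut_group_hom) fact
    have inv: "?\<psi> (\<phi> g) = g" if "g \<in> carrier G" for g
      using that * by (simp add: PAut_carrier_iff bij_betw_def)
    have "\<exists>g\<in>carrier G. ?\<psi> (L (v, True)) = conj_gen g v" if v: "v \<in> V" for v
    proof -
      obtain g where g: "g \<in> carrier G" "\<phi> (L (v, True)) = conj_gen g v"
        using PAut_conj_gen[OF * v] by blast
      \<comment> \<open>Applying the inverse \<open>?\<psi>\<close> to the equation for
        \<open>\<phi> (L (v, True))\<close> and solving for the image of \<open>v\<close> yields the
        conjugator \<open>inv (?\<psi> g)\<close>.\<close>
      have "?\<psi> (conj_gen g v) = L (v, True)" using inv[of "L (v, True)"] v g by simp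
      then have "?\<psi> g \<otimes> ?\<psi> (L (v, True)) \<otimes> inv (?\<psi> g) = L (v, True)"
        using v g by (simp del: restrict_apply)
      moreover have "inv (?\<psi> g) \<otimes> (?\<psi> g \<otimes> ?\<psi> (L (v, True)) \<otimes> inv (?\<psi> g)) \<otimes> ?\<psi> g
          = ?\<psi> (L (v, True))"
        using v g by (simp add: m_assoc del: restrict_apply)
      ultimately have "?\<psi> (L (v, True)) = conj_gen (inv (?\<psi> g)) v"
        using v g by (simp del: restrict_apply)
      moreover have "inv (?\<psi> g) \<in> carrier G" using g by (simp del: restrict_apply)
      ultimately show ?thesis by blast
    qed
    with \<psi> show "inv\<^bsub>BijGroup (carrier G)\<^esub> \<phi> \<in> carrier (PAut \<Gamma>)"
      using PAut_Bij[OF *] by (simp add: inv_BijGroup PAut_carrier_iff Bij_def del: restrict_apply)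
  qed
  then have "group (BijGroup (carrier G) \<lparr>carrier := carrier (PAut \<Gamma>)\<rparr>)"
    by (rule subgroup.subgroup_is_group[OF _ group_BijGroup])
  moreover have "BijGroup (carrier G) \<lparr>carrier := carrier (PAut \<Gamma>)\<rparr> = PAut \<Gamma>"
    by (simp add: PAut_def AutoGroup_def flip: G_def)
  ultimately show ?thesis by simp
qed

end

sublocale raag \<subseteq> PAut: group "PAut \<Gamma>"
  by (rule group_PAut)

section \<open>Partial conjugations and components of star complements\<close>

context raag
begin

text \<open>\<open>C\<close> is a union of connected components of the complement of the star of \<open>x\<close>.\<close>

definition part :: "'a \<Rightarrow> 'a set \<Rightarrow> bool" where
  "part x C \<longleftrightarrow> x \<in> V \<and> C \<subseteq> V - st x \<and> (\<forall>v\<in>C. \<forall>u\<in>lk v. u \<in> C \<or> u \<in> st x)"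

definition pconj :: "'a \<times> bool \<Rightarrow> 'a set \<Rightarrow> 'a word set \<Rightarrow> 'a word set" where
  "pconj s C = (SOME \<phi>. \<phi> \<in> hom G G \<and> \<phi> \<in> extensional (carrier G) \<and>
    (\<forall>v\<in>V. \<phi> (L (v, True)) = (if v \<in> C then conj_gen (L s) v else L (v, True))))"

text \<open>The prescribed images satisfy the relations. The critical case is an edge leaving
  \<open>C\<close>: its outer end lies in the star of \<open>fst s\<close>, so it commutes with
  \<open>L s\<close> as well as with its neighbour in \<open>C\<close>.\<close>

lemma pconj:
  assumes "part (fst s) C"
  shows "pconj s C \<in> hom G G" "pconj s C \<in> extensional (carrier G)"
    and "v \<in> V \<Longrightarrow> pconj s C (L (v, True)) = (if v \<in> C then conj_gen (L s) v else L (v, True))"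
proof -
  let ?f = "\<lambda>v. if v \<in> C then conj_gen (L s) v else L (v, True)"
  have s: "fst s \<in> V" using assms by (simp add: part_def)
  have comm: "?f v \<otimes> ?f u = ?f u \<otimes> ?f v" if u: "u \<in> lk v" for u v
  proof -
    have V: "v \<in> V" "u \<in> V" using u lk_V by auto
    have c: "L (v, True) \<otimes> L (u, True) = L (u, True) \<otimes> L (v, True)" by (rule gen_commute[OF u])
    have mixed: "conj_gen (L s) v \<otimes> L (u, True) = L (u, True) \<otimes> conj_gen (L s) v"
      if "u \<in> lk v" "u \<notin> C" "v \<in> C" for u v
    proof -
      have V: "v \<in> V" "u \<in> V" using that lk_V by auto
      have "u \<in> st (fst s)" using that assms by (auto simp: part_def)
      then have us: "L (u, True) \<otimes> L s = L s \<otimes> L (u, True)" using L_commute s by simp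
      then have us': "L (u, True) \<otimes> inv (L s) = inv (L s) \<otimes> L (u, True)"
        using commute_inv[of "L s" "L (u, True)"] s V by simp
      have uv: "L (u, True) \<otimes> L (v, True) = L (v, True) \<otimes> L (u, True)"
        using gen_commute[OF that(1)] by simp
      have "L (u, True) \<otimes> (L s \<otimes> L (v, True) \<otimes> inv (L s)) = L s \<otimes> L (v, True) \<otimes> inv (L s) \<otimes> L (u, True)"
        using s V us us' uv by (intro commute_mult) simp_all
      then show ?thesis by simp
    qed
    consider "v \<in> C" "u \<in> C" | "v \<in> C" "u \<notin> C" | "v \<notin> C" "u \<in> C" | "v \<notin> C" "u \<notin> C" by blast
    then show ?thesis
    proof cases
      case 1
      have *: "conj_gen (L s) v \<otimes> conj_gen (L s) u
          = L s \<otimes> (L (v, True) \<otimes> L (u, True)) \<otimes> inv (L s)" if "v \<in> V" "u \<in> V" for v u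
        using that s by (simp add: m_assoc)
      show ?thesis using 1 *[OF V] *[OF V(2,1)] c by simp
    next
      case 2
      with mixed[OF u] show ?thesis by simp
    next
      case 3
      with mixed[of v u] u lk_sym show ?thesis by auto
    qed (use c in simp)
  qed
  have "\<And>v. v \<in> V \<Longrightarrow> ?f v \<in> carrier G" using s by simp
  then obtain \<phi> where "\<phi> \<in> hom G G" "\<phi> \<in> extensional (carrier G)"
    "\<And>v. v \<in> V \<Longrightarrow> \<phi> (L (v, True)) = ?f v"
    using lift_hom[OF is_group, of ?f] comm by blast
  then have "\<exists>\<phi>. \<phi> \<in> hom G G \<and> \<phi> \<in> extensional (carrier G) \<and> (\<forall>v\<in>V. \<phi> (L (v, True)) = ?f v)"
    by blast
  from someI_ex[OF this]
  show "pconj s C \<in> hom G G" "pconj s C \<in> extensional (carrier G)"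
    "v \<in> V \<Longrightarrow> pconj s C (L (v, True)) = ?f v"
    unfolding pconj_def by auto
qed

lemma pconj_group_hom: "part (fst s) C \<Longrightarrow> group_hom G G (pconj s C)"
  using pconj(1) by unfold_locales

lemma pconj_fixes:
  assumes "part (fst s) C" "fst t \<in> V - C"
  shows "pconj s C (L t) = L t"
proof -
  interpret group_hom G G "pconj s C" using assms(1) by (rule pconj_group_hom)
  obtain v b where "t = (v, b)" by fastforce
  then show ?thesis using assms pconj(3)[OF assms(1), of v] by (cases b) (auto simp: L_False)
qed

lemma pconj_moves:
  assumes "part (fst s) C" "v \<in> C"
  shows "pconj s C (L (v, True)) = conj_gen (L s) v"
  using assms pconj(3)[OF assms(1), of v] by (auto simp: part_def)

lemma pconj_bar:
  assumes "part (fst s) C" "g \<in> carrier G"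
  shows "pconj s C (pconj (bar s) C g) = g"
proof -
  have p: "part (fst (bar s)) C" using assms by simp
  have x: "fst s \<in> V - C" using assms by (auto simp: part_def)
  interpret a: group_hom G G "pconj s C" using assms(1) by (rule pconj_group_hom)
  interpret b: group_hom G G "pconj (bar s) C" using p by (rule pconj_group_hom)
  have "(pconj s C \<circ> pconj (bar s) C) g = id g"
  proof (rule hom_eqI[OF is_group _ _ _ assms(2)])
    show "pconj s C \<circ> pconj (bar s) C \<in> hom G G"
      using pconj(1)[OF p] pconj(1)[OF assms(1)] by (rule Group.hom_compose)
    show "id \<in> hom G G" by (auto simp: hom_def)
    fix v assume v: "v \<in> V"
    show "(pconj s C \<circ> pconj (bar s) C) (L (v, True)) = id (L (v, True))"
    proof (cases "v \<in> C")
      case True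
      have "pconj s C (conj_gen (L (bar s)) v) = L (bar s) \<otimes> conj_gen (L s) v \<otimes> inv (L (bar s))"
        using True v x assms pconj_fixes[of s C "bar s"] pconj_moves[of s C v] by simp
      also have "\<dots> = L (v, True)" using x v by (simp add: L_bar m_assoc)
      finally show ?thesis using pconj_moves[OF p True] by simp
    next
      case False
      with v p assms show ?thesis by (simp add: pconj_fixes)
    qed
  qed
  then show ?thesis by simp
qed

lemma pconj_PAut:
  assumes "part (fst s) C"
  shows "pconj s C \<in> carrier (PAut \<Gamma>)"
proof -
  have p: "part (fst (bar s)) C" using assms by simp
  interpret a: group_hom G G "pconj s C" using assms(1) by (rule pconj_group_hom)
  interpret b: group_hom G G "pconj (bar s) C" using p by (rule pconj_group_hom)
  have "bij_betw (pconj s C) (carrier G) (carrier G)"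
    using pconj_bar[OF assms] pconj_bar[OF p]
    by (intro bij_betw_byWitness[where f' = "pconj (bar s) C"]) auto
  moreover have "\<exists>g\<in>carrier G. pconj s C (L (v, True)) = conj_gen g v" if "v \<in> V" for v
  proof (cases "v \<in> C")
    case True
    then show ?thesis using pconj_moves assms by (intro bexI[of _ "L s"]) (auto simp: part_def)
  next
    case False
    then show ?thesis using pconj_fixes assms that by (intro bexI[of _ \<one>]) auto
  qed
  ultimately show ?thesis using pconj[OF assms] by (simp add: PAut_carrier_iff)
qed

lemma pconj_mult_bar:
  assumes "part (fst s) C"
  shows "pconj s C \<otimes>\<^bsub>PAut \<Gamma>\<^esub> pconj (bar s) C = \<one>\<^bsub>PAut \<Gamma>\<^esub>"
  using assms pconj_PAut[of s C] pconj_PAut[of "bar s" C] pconj_bar[OF assms]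
  by (simp add: PAut_mult PAut_one compose_def cong: restrict_cong)

lemma pconj_inv:
  assumes "part (fst s) C"
  shows "inv\<^bsub>PAut \<Gamma>\<^esub> (pconj s C) = pconj (bar s) C"
proof -
  show ?thesis
    using assms pconj_mult_bar[of "bar s" C] pconj_PAut[of s C] pconj_PAut[of "bar s" C]
    by (intro PAut.inv_equality) simp_all
qed

text \<open>For \<open>y\<close> outside \<open>st x\<close>, the connected component of
  \<open>y\<close> in the complement of \<open>st x\<close>; for \<open>y\<close> in
  \<open>st x\<close>, just the singleton of \<open>y\<close>.\<close>

definition component :: "'a \<Rightarrow> 'a \<Rightarrow> 'a set" where
  "component x y = {z. (y, z) \<in> {(a, b). b \<in> lk a \<and> a \<notin> st x \<and> b \<notin> st x}\<^sup>*}"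

lemma component_refl [simp]: "y \<in> component x y"
  by (simp add: component_def)

lemma component_step:
  "z \<in> component x y \<Longrightarrow> z \<notin> st x \<Longrightarrow> u \<in> lk z \<Longrightarrow> u \<notin> st x \<Longrightarrow> u \<in> component x y"
  by (auto simp: component_def intro: rtrancl_into_rtrancl)

lemma component_induct [consumes 1, case_names refl step]:
  assumes "z \<in> component x y" and "P y"
    and "\<And>z u. z \<in> component x y \<Longrightarrow> P z \<Longrightarrow> u \<in> lk z \<Longrightarrow> z \<notin> st x \<Longrightarrow> u \<notin> st x \<Longrightarrow> P u"
  shows "P z"
proof -
  have "(y, z) \<in> {(a, b). b \<in> lk a \<and> a \<notin> st x \<and> b \<notin> st x}\<^sup>*" using assms(1) by (simp add: component_def)
  then show ?thesis by induction (auto simp: assms component_def)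
qed

lemma component_subset:
  assumes "y \<in> V - st x"
  shows "component x y \<subseteq> V - st x"
proof
  fix z assume "z \<in> component x y"
  then show "z \<in> V - st x" using assms by (induction rule: component_induct) (auto dest: lk_V)
qed

lemma part_component:
  assumes "x \<in> V" "y \<in> V - st x"
  shows "part x (component x y)"
  unfolding part_def
  using assms component_subset[OF assms(2)] component_step[of _ x y] by blast

lemma component_sym:
  assumes "z \<in> component x y"
  shows "y \<in> component x z"
proof -
  let ?R = "{(a, b). b \<in> lk a \<and> a \<notin> st x \<and> b \<notin> st x}"
  have "sym ?R" using lk_sym by (auto simp: sym_def)
  then have "sym (?R\<^sup>*)" by (rule sym_rtrancl)
  with assms show ?thesis by (auto simp: component_def dest: symD)
qed

lemma component_eq:
  assumes "z \<in> component x y"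
  shows "component x z = component x y"
  using assms component_sym[OF assms] by (auto simp: component_def dest: rtrancl_trans)

section \<open>Shortening conjugators\<close>

definition conj_len :: "('a word set \<Rightarrow> 'a word set) \<Rightarrow> 'a \<Rightarrow> nat" where
  "conj_len \<phi> v = (LEAST n. \<exists>g\<in>carrier G. len g = n \<and> \<phi> (L (v, True)) = conj_gen g v)"

lemma conj_len_le:
  "g \<in> carrier G \<Longrightarrow> \<phi> (L (v, True)) = conj_gen g v \<Longrightarrow> conj_len \<phi> v \<le> len g"
  unfolding conj_len_def by (rule Least_le) blast

lemma conj_gen_commuting:
  assumes "g \<in> carrier G" "v \<in> V"
  shows "conj_gen (g \<otimes> L (v, b)) v = conj_gen g v"
proof -
  have "conj_gen (g \<otimes> L (v, b)) v = g \<otimes> (L (v, b) \<otimes> L (v, True)) \<otimes> inv (L (v, b)) \<otimes> inv g"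
    using assms by (simp add: inv_mult_group m_assoc)
  also have "L (v, b) \<otimes> L (v, True) = L (v, True) \<otimes> L (v, b)"
    using L_commute[of "(v, b)" "(v, True)"] assms by simp
  finally show ?thesis using assms by (simp add: m_assoc)
qed

text \<open>Multiplying \<open>g\<close> on the right by a letter \<open>v\<close> does not change
  the conjugate of \<open>v\<close>; a shortest conjugator therefore cannot be shortened in this
  way, which is the condition \<open>w_min\<close>.\<close>

lemma conj_len_witness:
  assumes "\<phi> \<in> carrier (PAut \<Gamma>)" "v \<in> V"
  obtains g where "g \<in> carrier G" "\<phi> (L (v, True)) = conj_gen g v" "len g = conj_len \<phi> v"
    "\<And>b. inv g \<notin> H (v, b)"
proof -
  have "\<exists>n. \<exists>g\<in>carrier G. len g = n \<and> \<phi> (L (v, True)) = conj_gen g v"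
    using PAut_conj_gen[OF assms] by blast
  from LeastI_ex[OF this] obtain g
    where g: "g \<in> carrier G" "\<phi> (L (v, True)) = conj_gen g v" "len g = conj_len \<phi> v"
    unfolding conj_len_def by auto
  have "inv g \<notin> H (v, b)" for b
  proof
    assume b: "inv g \<in> H (v, b)"
    let ?h = "g \<otimes> L (v, b)"
    have h: "?h \<in> carrier G" using g assms by simp
    have "inv ?h = L (bar (v, b)) \<otimes> inv g"
      using g assms L_bar[of "(v, b)"] by (simp add: inv_mult_group)
    then have "len (inv ?h) < len (inv g)" using len_shorten_one[OF b] assms by simp
    then have "len ?h < len g" using len_inv g h by simp
    moreover have "conj_len \<phi> v \<le> len ?h"
      using conj_len_le[OF h] conj_gen_commuting g assms by simp
    ultimately show False using g by simp
  qed
  with that g show thesis by blast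
qed

lemma reduce:
  assumes \<phi>: "\<phi> \<in> carrier (PAut \<Gamma>)" and "\<phi> \<noteq> \<one>\<^bsub>PAut \<Gamma>\<^esub>"
  obtains s y where "fst s \<in> V" "y \<in> V - st (fst s)"
    "(\<Sum>v\<in>V. conj_len (\<phi> \<otimes>\<^bsub>PAut \<Gamma>\<^esub> pconj s (component (fst s) y)) v) < (\<Sum>v\<in>V. conj_len \<phi> v)"
proof -
  interpret \<phi>: group_hom G G \<phi> by (rule PAut_group_hom[OF \<phi>])
  have "\<exists>g. v \<in> V \<longrightarrow> g \<in> carrier G \<and> \<phi> (L (v, True)) = conj_gen g v \<and>
      len g = conj_len \<phi> v \<and> (\<forall>b. inv g \<notin> H (v, b))" for v
    using conj_len_witness[OF \<phi>, of v] by metis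
  then obtain w where w: "\<And>v. v \<in> V \<Longrightarrow> w v \<in> carrier G \<and> \<phi> (L (v, True)) = conj_gen (w v) v \<and>
      len (w v) = conj_len \<phi> v \<and> (\<forall>b. inv (w v) \<notin> H (v, b))"
    by metis
  interpret c: conjugating \<Gamma> G \<phi> w
    using w \<phi> by unfold_locales (auto simp: PAut_carrier_iff)
  \<comment> \<open>Otherwise \<open>\<phi>\<close> would be irreducible and, by ping-pong, fix all
    generators.\<close>
  have "\<exists>x y b. x \<in> V \<and> y \<in> V \<and> y \<notin> st x \<and> inv (w x) \<otimes> w y \<in> H (x, b)"
  proof (rule ccontr)
    assume "\<not> ?thesis"
    then interpret i: irreducible_conjugating \<Gamma> G \<phi> w by unfold_locales blast
    have "\<phi> ` carrier G = carrier G" using \<phi> by (auto simp: PAut_carrier_iff bij_betw_def)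
    then have "\<phi> = \<one>\<^bsub>PAut \<Gamma>\<^esub>"
      using \<phi> PAut.one_closed i.fixes_gen by (intro PAut_eqI) (auto simp: PAut_one)
    with assms show False by simp
  qed
  then obtain x y b where xy: "x \<in> V" "y \<in> V" "y \<notin> st x" "inv (w x) \<otimes> w y \<in> H (x, b)" by blast
  let ?s = "(x, b)" and ?C = "component x y"
  let ?\<psi> = "\<phi> \<otimes>\<^bsub>PAut \<Gamma>\<^esub> pconj (bar ?s) ?C"
  have C: "part (fst (bar ?s)) ?C" using xy part_component by simp
  have CV: "z \<in> V" if "z \<in> ?C" for z using that C by (auto simp: part_def)
  \<comment> \<open>The condition spreads from \<open>y\<close> over its component, so one partial
    conjugation serves all vertices of \<open>?C\<close>.\<close>
  have inH: "inv (w x) \<otimes> w z \<in> H ?s" if "z \<in> ?C" for z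
    using that
  proof (induction rule: component_induct)
    case refl
    then show ?case by (rule xy)
  next
    case (step z u)
    then show ?case using c.halfspace_spreads[of ?s z u] CV xy by simp
  qed
  have \<psi>: "?\<psi> (L (v, True)) = \<phi> (pconj (bar ?s) ?C (L (v, True)))" if "v \<in> V" for v
    using \<phi> pconj_PAut[OF C] that by (simp add: PAut_apply)
  have less: "conj_len ?\<psi> v < conj_len \<phi> v" if v: "v \<in> ?C" for v
  proof -
    \<comment> \<open>The new conjugator of \<open>v\<close>. By \<open>inH\<close> the translated
      wall of \<open>?s\<close> separates \<open>\<one>\<close> from \<open>w v\<close>, and the
      factor \<open>\<phi> (L (bar ?s))\<close> removes this crossing.\<close>
    let ?g = "\<phi> (L (bar ?s)) \<otimes> w v"
    have W: "w v \<in> carrier G" "w x \<in> carrier G" "v \<in> V" using w xy v CV by auto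
    have "?\<psi> (L (v, True)) = \<phi> (conj_gen (L (bar ?s)) v)"
      using \<psi> v W pconj_moves[OF C] by simp
    also have "\<dots> = conj_gen ?g v"
      using W xy w by (simp add: inv_mult_group m_assoc)
    finally have "conj_len ?\<psi> v \<le> len ?g" using conj_len_le W xy by simp
    also have "?g = w x \<otimes> L (bar ?s) \<otimes> inv (w x) \<otimes> w v" using c.\<phi>_L[of "bar ?s"] xy by simp
    also have "len \<dots> < len (w v)" using len_shorten[of "w x" "w v" ?s] W inH v xy w by simp
    finally show ?thesis using w W by simp
  qed
  have le: "conj_len ?\<psi> v \<le> conj_len \<phi> v" if v: "v \<in> V" for v
  proof (cases "v \<in> ?C")
    case True
    then show ?thesis using less order.strict_implies_order by blast
  next
    case False
    then have "?\<psi> (L (v, True)) = \<phi> (L (v, True))" using \<psi> v pconj_fixes[OF C] by simp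
    then show ?thesis by (simp add: conj_len_def)
  qed
  have "(\<Sum>v\<in>V. conj_len ?\<psi> v) < (\<Sum>v\<in>V. conj_len \<phi> v)"
    using finite_V le less[of y] xy by (intro sum_strict_mono_ex1) auto
  with that[of "bar ?s" y] xy show thesis by simp
qed

text \<open>Laurence's theorem: while \<open>\<phi>\<close> is not the identity, some partial conjugation shortens its
  conjugators.\<close>

theorem partial_conjugations_generate:
  assumes T: "subgroup T (PAut \<Gamma>)"
    and gen: "\<And>s y. fst s \<in> V \<Longrightarrow> y \<in> V - st (fst s) \<Longrightarrow> pconj s (component (fst s) y) \<in> T"
  shows "T = carrier (PAut \<Gamma>)"
proof -
  interpret T: subgroup T "PAut \<Gamma>" by (rule T)
  have "\<phi> \<in> T" if "\<phi> \<in> carrier (PAut \<Gamma>)" for \<phi>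
    using that
  proof (induction "\<Sum>v\<in>V. conj_len \<phi> v" arbitrary: \<phi> rule: less_induct)
    case less
    show ?case
    proof (cases "\<phi> = \<one>\<^bsub>PAut \<Gamma>\<^esub>")
      case False
      with less.prems obtain s y where sy: "fst s \<in> V" "y \<in> V - st (fst s)"
        "(\<Sum>v\<in>V. conj_len (\<phi> \<otimes>\<^bsub>PAut \<Gamma>\<^esub> pconj s (component (fst s) y)) v) < (\<Sum>v\<in>V. conj_len \<phi> v)"
        using reduce by metis
      let ?p = "pconj s (component (fst s) y)"
      have p: "?p \<in> T" using gen sy by blast
      then have "\<phi> \<otimes>\<^bsub>PAut \<Gamma>\<^esub> ?p \<in> T" using less sy by auto
      then have "\<phi> \<otimes>\<^bsub>PAut \<Gamma>\<^esub> ?p \<otimes>\<^bsub>PAut \<Gamma>\<^esub> inv\<^bsub>PAut \<Gamma>\<^esub> ?p \<in> T" using p by blast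
      then show ?thesis using p less.prems by (simp add: PAut.m_assoc)
    qed simp
  qed
  with T.subset show ?thesis by blast
qed

section \<open>Commuting partial conjugations and inner automorphisms\<close>

lemma opposite_letter_occurs:
  assumes "word_expo x ((x, b) # u) = 0"
  shows "(x, \<not> b) \<in> set u"
proof (rule ccontr)
  assume "(x, \<not> b) \<notin> set u"
  then have "if b then word_expo x u \<ge> 0 else word_expo x u \<le> 0"
    by (induction u) (auto split: if_splits)
  with assms show False by (auto split: if_splits)
qed

lemma expo_L: "fst l \<in> V \<Longrightarrow> expo x (L l) = (if fst l = x then if snd l then 1 else - 1 else 0)"
  using expo_cl[of "[l]"] by simp

lemma commute_cl:
  assumes "g \<in> carrier G" "u \<in> words V" "\<And>l. l \<in> set u \<Longrightarrow> g \<otimes> L l = L l \<otimes> g"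
  shows "g \<otimes> cl u = cl u \<otimes> g"
  using assms(2,3)
proof (induction u)
  case (Cons l u)
  then have "g \<otimes> (L l \<otimes> cl u) = L l \<otimes> cl u \<otimes> g" using assms(1) by (intro commute_mult) auto
  then show ?case using Cons cl_Cons[of l u] by simp
qed (use assms(1) in simp)

lemma pconj_commute_disjoint:
  assumes p: "part (fst s) C" "part (fst t) D" and "fst s \<notin> D" "fst t \<notin> C"
    and st: "C \<inter> D = {} \<or> L s \<otimes> L t = L t \<otimes> L s"
  shows "pconj s C \<otimes>\<^bsub>PAut \<Gamma>\<^esub> pconj t D = pconj t D \<otimes>\<^bsub>PAut \<Gamma>\<^esub> pconj s C"
proof -
  interpret a: group_hom G G "pconj s C" using p(1) by (rule pconj_group_hom)
  interpret b: group_hom G G "pconj t D" using p(2) by (rule pconj_group_hom)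
  note A = pconj_PAut[OF p(1)] pconj_PAut[OF p(2)]
  have V: "fst s \<in> V" "fst t \<in> V" using p by (auto simp: part_def)
  have stays: "pconj s C (L t) = L t" "pconj t D (L s) = L s" using V assms pconj_fixes by auto
  have "pconj s C (pconj t D (L (v, True))) = pconj t D (pconj s C (L (v, True)))"
    if v: "v \<in> V" for v
  proof -
    consider "v \<in> C" "v \<in> D" | "v \<in> C" "v \<notin> D" | "v \<notin> C" "v \<in> D" | "v \<notin> C" "v \<notin> D"
      by blast
    then show ?thesis
    proof cases
      case 1
      then have com: "L s \<otimes> L t = L t \<otimes> L s" using st by blast
      have "L t \<otimes> conj_gen (L s) v \<otimes> inv (L t) = (L t \<otimes> L s) \<otimes> L (v, True) \<otimes> inv (L t \<otimes> L s)"
        using V v by (simp add: inv_mult_group m_assoc)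
      also have "\<dots> = L s \<otimes> conj_gen (L t) v \<otimes> inv (L s)"
        unfolding com[symmetric] using V v by (simp add: inv_mult_group m_assoc)
      finally show ?thesis using 1 V v p by (simp add: pconj_moves stays)
    qed (use V v p in \<open>simp_all add: pconj_moves pconj_fixes stays\<close>)
  qed
  then show ?thesis using A by (intro PAut_eqI) (simp_all add: PAut_apply)
qed

text \<open>\<open>pconj t D\<close> conjugates the letter \<open>s\<close> along with
  \<open>C\<close>, and on \<open>C\<close> both composites are conjugation by
  \<open>L t \<otimes> L s\<close>.\<close>

lemma pconj_commute_nested:
  assumes p: "part (fst s) C" "part (fst t) D" and "fst s \<in> D" "fst t \<notin> C" "C \<subseteq> D"
  shows "pconj s C \<otimes>\<^bsub>PAut \<Gamma>\<^esub> pconj t D = pconj t D \<otimes>\<^bsub>PAut \<Gamma>\<^esub> pconj s C"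
proof -
  interpret a: group_hom G G "pconj s C" using p(1) by (rule pconj_group_hom)
  interpret b: group_hom G G "pconj t D" using p(2) by (rule pconj_group_hom)
  note A = pconj_PAut[OF p(1)] pconj_PAut[OF p(2)]
  have V: "fst s \<in> V" "fst t \<in> V" using p by (auto simp: part_def)
  have stays: "pconj s C (L t) = L t" using V assms pconj_fixes by auto
  have moves: "pconj t D (L s) = L t \<otimes> L s \<otimes> inv (L t)"
  proof -
    obtain x b where "s = (x, b)" by fastforce
    then show ?thesis using pconj_moves[OF p(2), of x] assms V
      by (cases b) (simp_all add: L_False inv_mult_group m_assoc)
  qed
  have "pconj s C (pconj t D (L (v, True))) = pconj t D (pconj s C (L (v, True)))"
    if v: "v \<in> V" for v
  proof -
    consider "v \<in> C" "v \<in> D" | "v \<notin> C" "v \<in> D" | "v \<notin> C" "v \<notin> D"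
      using assms by blast
    then show ?thesis
      by cases (use V v p in
        \<open>simp_all add: pconj_moves pconj_fixes stays moves inv_mult_group m_assoc\<close>)
  qed
  then show ?thesis using A by (intro PAut_eqI) (simp_all add: PAut_apply)
qed

lemma expo_pconj:
  assumes p: "part (fst s) C" and "g \<in> carrier G"
  shows "expo x (pconj s C g) = expo x g"
proof -
  interpret a: group_hom G G "pconj s C" using p by (rule pconj_group_hom)
  have V: "fst s \<in> V" using p by (auto simp: part_def)
  have gen: "expo x (pconj s C (L (v, True))) = expo x (L (v, True))" if "v \<in> V" for v
    using that p V pconj_moves[OF p] pconj_fixes[OF p] by (cases "v \<in> C") simp_all
  have "expo x (pconj s C (L l)) = expo x (L l)" if "fst l \<in> V" for l
  proof -
    obtain v b where "l = (v, b)" by fastforce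
    then show ?thesis using that gen[of v] by (cases b) (simp_all add: L_False)
  qed
  with assms(2) show ?thesis by (induction rule: gen_induct) simp_all
qed

section \<open>Inner automorphisms\<close>

definition inner :: "'a word set \<Rightarrow> 'a word set \<Rightarrow> 'a word set"
  where "inner g = (\<lambda>x\<in>carrier G. g \<otimes> x \<otimes> inv g)"

lemma Inn_eq: "Inn G = inner ` carrier G"
  by (simp add: Inn_def inner_def[abs_def])

lemma inner_hom_self: "g \<in> carrier G \<Longrightarrow> inner g \<in> hom G G"
  by (rule homI) (simp_all add: inner_def m_assoc)

lemma inner_PAut:
  assumes "g \<in> carrier G"
  shows "inner g \<in> carrier (PAut \<Gamma>)"
proof -
  have "bij_betw (inner g) (carrier G) (carrier G)"
    by (rule bij_betw_byWitness[where f' = "inner (inv g)"])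
      (use assms in \<open>auto simp: inner_def m_assoc\<close>)
  moreover have "\<exists>h\<in>carrier G. inner g (L (v, True)) = conj_gen h v" if "v \<in> V" for v
    using that assms by (intro bexI[of _ g]) (simp_all add: inner_def)
  ultimately show ?thesis using inner_hom_self[OF assms] by (simp add: PAut_carrier_iff inner_def)
qed

lemma inner_hom: "inner \<in> hom G (PAut \<Gamma>)"
proof (rule homI)
  fix g h assume gh: "g \<in> carrier G" "h \<in> carrier G"
  show "inner (g \<otimes> h) = inner g \<otimes>\<^bsub>PAut \<Gamma>\<^esub> inner h"
  proof (rule PAut_eqI)
    fix v assume "v \<in> V"
    with gh show "inner (g \<otimes> h) (L (v, True)) = (inner g \<otimes>\<^bsub>PAut \<Gamma>\<^esub> inner h) (L (v, True))"
      by (simp add: PAut_apply inner_PAut) (simp add: inner_def inv_mult_group m_assoc)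
  qed (use gh inner_PAut in simp_all)
qed (rule inner_PAut)

lemma Inn_normal: "Inn G \<lhd> PAut \<Gamma>"
proof -
  interpret i: group_hom G "PAut \<Gamma>" inner using inner_hom by unfold_locales
  have "\<phi> \<otimes>\<^bsub>PAut \<Gamma>\<^esub> inner g \<otimes>\<^bsub>PAut \<Gamma>\<^esub> inv\<^bsub>PAut \<Gamma>\<^esub> \<phi> \<in> Inn G"
    if \<phi>: "\<phi> \<in> carrier (PAut \<Gamma>)" and g: "g \<in> carrier G" for \<phi> g
  proof -
    interpret f: group_hom G G \<phi> by (rule PAut_group_hom[OF \<phi>])
    have "\<phi> \<otimes>\<^bsub>PAut \<Gamma>\<^esub> inner g = inner (\<phi> g) \<otimes>\<^bsub>PAut \<Gamma>\<^esub> \<phi>"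
      using \<phi> g inner_PAut by (intro PAut_eqI) (simp_all add: PAut_apply inner_def)
    then have "\<phi> \<otimes>\<^bsub>PAut \<Gamma>\<^esub> inner g \<otimes>\<^bsub>PAut \<Gamma>\<^esub> inv\<^bsub>PAut \<Gamma>\<^esub> \<phi> = inner (\<phi> g)"
      using \<phi> g inner_PAut by (simp add: PAut.m_assoc)
    then show ?thesis using g by (simp add: Inn_eq)
  qed
  moreover have "subgroup (Inn G) (PAut \<Gamma>)"
    unfolding Inn_eq by (rule i.img_is_subgroup)
  ultimately show ?thesis by (auto simp: PAut.normal_inv_iff Inn_eq)
qed

end

section \<open>The group generated by the parts of a partition system\<close>

text \<open>The families \<^term>\<open>P x\<close> are partitions of the complements of the stars into unions of
  components; the generators of the group acting by partial conjugations are numbered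
  by \<open>i < N\<close>, the \<open>i\<close>th one conjugating \<open>piece i\<close> by \<open>center i\<close>.\<close>

locale partition_system = raag +
  fixes P :: "'a \<Rightarrow> 'a set set" and N :: nat and center :: "nat \<Rightarrow> 'a" and piece :: "nat \<Rightarrow> 'a set"
  assumes P_part: "x \<in> V \<Longrightarrow> C \<in> P x \<Longrightarrow> part x C"
    and P_nonempty: "x \<in> V \<Longrightarrow> C \<in> P x \<Longrightarrow> C \<noteq> {}"
    and P_cover: "x \<in> V \<Longrightarrow> y \<in> V - st x \<Longrightarrow> \<exists>C\<in>P x. y \<in> C"
    and P_disjoint: "x \<in> V \<Longrightarrow> C \<in> P x \<Longrightarrow> D \<in> P x \<Longrightarrow> C \<noteq> D \<Longrightarrow> C \<inter> D = {}"
    and P_nested: "x \<in> V \<Longrightarrow> y \<in> V \<Longrightarrow> y \<notin> st x \<Longrightarrow> C \<in> P x \<Longrightarrow> y \<notin> C \<Longrightarrow>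
      D \<in> P y \<Longrightarrow> x \<in> D \<Longrightarrow> C \<subseteq> D"
    and numbering: "bij_betw (\<lambda>i. (center i, piece i)) {..<N} (SIGMA x:V. P x)"
begin

definition \<Delta> :: "nat pair_pre_digraph" where
  "\<Delta> = \<lparr>pverts = {..<N},
     parcs = {(i, j). i < N \<and> j < N \<and> i \<noteq> j \<and> \<not> (center j \<in> piece i \<and> center i \<in> piece j)}\<rparr>"

abbreviation E where "E \<equiv> RAAG \<Delta>"

lemma pair_graph_\<Delta>: "pair_graph \<Delta>"
proof
  have "parcs \<Delta> \<subseteq> {..<N} \<times> {..<N}" by (auto simp: \<Delta>_def)
  then show "finite (parcs \<Delta>)" by (rule finite_subset) simp
qed (auto simp: \<Delta>_def symmetric_conv)

end

sublocale partition_system \<subseteq> E: raag \<Delta> "RAAG \<Delta>"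
  by (rule raag.intro) (simp_all add: pair_graph_\<Delta>)

context partition_system
begin

lemma EV [simp]: "E.V = {..<N}" by (simp add: \<Delta>_def)

lemma center_V: "i < N \<Longrightarrow> center i \<in> V" and piece_P: "i < N \<Longrightarrow> piece i \<in> P (center i)"
  using numbering by (auto simp: bij_betw_def)

lemma index_exists: 
  assumes "x \<in> V" "C \<in> P x"
  obtains i where "i < N" "center i = x" "piece i = C"
proof -
  have "(x, C) \<in> (\<lambda>i. (center i, piece i)) ` {..<N}" using numbering assms by (simp add: bij_betw_def)
  with that show thesis by auto
qed

lemma index_inj: "i < N \<Longrightarrow> j < N \<Longrightarrow> center i = center j \<Longrightarrow> piece i = piece j \<Longrightarrow> i = j"
  using numbering by (auto simp: bij_betw_def inj_on_def)

lemma index_disjoint: "i < N \<Longrightarrow> j < N \<Longrightarrow> center i = center j \<Longrightarrow> i \<noteq> j \<Longrightarrow> piece i \<inter> piece j = {}"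
  using P_disjoint[of "center i" "piece i" "piece j"] center_V piece_P[of i] piece_P[of j] index_inj by metis

lemma piece_part: "i < N \<Longrightarrow> part (center i) (piece i)"
  using P_part center_V piece_P by blast

lemma piece_disjoint_st: "i < N \<Longrightarrow> piece i \<inter> st (center i) = {}"
  using piece_part unfolding part_def by blast

lemma E_lk_iff:
  "j \<in> E.lk i \<longleftrightarrow> i < N \<and> j < N \<and> i \<noteq> j \<and> \<not> (center j \<in> piece i \<and> center i \<in> piece j)"
  by (simp add: link_def \<Delta>_def)

lemma E_commute:
  assumes "i < N" "j < N" "\<not> (center j \<in> piece i \<and> center i \<in> piece j)"
  shows "E.L (i, b) \<otimes>\<^bsub>E\<^esub> E.L (j, c) = E.L (j, c) \<otimes>\<^bsub>E\<^esub> E.L (i, b)"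
  using assms E.L_commute[of "(i, b)" "(j, c)"] by (auto simp: E.st_def E_lk_iff)

abbreviation pc where "pc l \<equiv> pconj (center (fst l), snd l) (piece (fst l))"

text \<open>If the centers lie in each other's stars, they commute and neither is moved. Otherwise
  one of them, say \<open>center j\<close>, lies outside the piece of the other. By
  \<open>P_nested\<close>, \<open>piece i\<close> is then contained in the part of
  \<open>center j\<close> around \<open>center i\<close>. This part is \<open>piece j\<close>, the
  nested case, or is disjoint from it.\<close>

lemma pc_commute:
  assumes ij: "j \<in> E.lk i"
  shows "pc (i, b) \<otimes>\<^bsub>PAut \<Gamma>\<^esub> pc (j, c) = pc (j, c) \<otimes>\<^bsub>PAut \<Gamma>\<^esub> pc (i, b)"
proof -
  have commute: "pc (i, b) \<otimes>\<^bsub>PAut \<Gamma>\<^esub> pc (j, c) = pc (j, c) \<otimes>\<^bsub>PAut \<Gamma>\<^esub> pc (i, b)"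
    if ij: "i < N" "j < N" and st: "center j \<notin> st (center i)" and n: "center j \<notin> piece i" for i j b c
  proof (cases "center i \<in> piece j")
    case True
    then have "piece i \<subseteq> piece j" using P_nested st n ij center_V piece_P by blast
    then show ?thesis using pconj_commute_nested[of "(center i, b)" "piece i" "(center j, c)" "piece j"]
      piece_part ij n True by simp
  next
    case False
    have "center i \<in> V - st (center j)" using st st_sym center_V ij by blast
    then obtain D where D: "D \<in> P (center j)" "center i \<in> D" using P_cover center_V ij by blast
    then have "piece i \<subseteq> D" using P_nested st n ij center_V piece_P by blast
    moreover have "piece j \<inter> D = {}" using P_disjoint[OF center_V piece_P D(1)] ij False D by blast
    ultimately have "piece i \<inter> piece j = {}" by blast
    then show ?thesis using pconj_commute_disjoint[of "(center i, b)" "piece i" "(center j, c)" "piece j"]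
      piece_part ij n False by simp
  qed
  have N: "i < N" "j < N" "i \<noteq> j" "\<not> (center j \<in> piece i \<and> center i \<in> piece j)" using ij by (auto simp: E_lk_iff)
  show ?thesis
  proof (cases "center j \<in> st (center i)")
    case True
    then have "center j \<notin> piece i" "center i \<notin> piece j" using piece_disjoint_st N st_sym by blast+
    moreover have "L (center i, b) \<otimes> L (center j, c) = L (center j, c) \<otimes> L (center i, b)"
      using L_commute[of "(center i, b)" "(center j, c)"] True st_sym center_V N by simp
    ultimately show ?thesis using pconj_commute_disjoint[of "(center i, b)" "piece i" "(center j, c)" "piece j"]
      piece_part N by simp
  next
    case False
    then have "center i \<notin> st (center j)" using st_sym by blast
    show ?thesis
    proof (cases "center j \<in> piece i")
      case True
      with N have "center i \<notin> piece j" by simp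
      with commute[of j i c b] N \<open>center i \<notin> st (center j)\<close> show ?thesis by simp
    next
      case False
      with commute[of i j b c] N \<open>center j \<notin> st (center i)\<close> show ?thesis by simp
    qed
  qed
qed

lemma pc_PAut: "i < N \<Longrightarrow> pc (i, b) \<in> carrier (PAut \<Gamma>)"
  using pconj_PAut piece_part by simp

definition \<Phi> :: "nat word set \<Rightarrow> 'a word set \<Rightarrow> 'a word set" where
  "\<Phi> = (SOME \<phi>. \<phi> \<in> hom E (PAut \<Gamma>) \<and> (\<forall>i<N. \<phi> (E.L (i, True)) = pc (i, True)))"

lemma \<Phi>_hom: "\<Phi> \<in> hom E (PAut \<Gamma>)" and \<Phi>_gen: "i < N \<Longrightarrow> \<Phi> (E.L (i, True)) = pc (i, True)"
proof -
  have "\<exists>\<phi>. \<phi> \<in> hom E (PAut \<Gamma>) \<and> (\<forall>i<N. \<phi> (E.L (i, True)) = pc (i, True))"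
  proof (rule E.lift_hom[OF group_PAut, of "\<lambda>i. pc (i, True)"])
    show "pc (i, True) \<in> carrier (PAut \<Gamma>)" if "i \<in> E.V" for i
      using that pc_PAut by simp
    show "pc (i, True) \<otimes>\<^bsub>PAut \<Gamma>\<^esub> pc (j, True) = pc (j, True) \<otimes>\<^bsub>PAut \<Gamma>\<^esub> pc (i, True)"
      if "j \<in> E.lk i" for i j
      using that by (rule pc_commute)
  qed auto
  from someI_ex[OF this]
  show "\<Phi> \<in> hom E (PAut \<Gamma>)" "i < N \<Longrightarrow> \<Phi> (E.L (i, True)) = pc (i, True)"
    unfolding \<Phi>_def by auto
qed

end

sublocale partition_system \<subseteq> \<Phi>: group_hom "RAAG \<Delta>" "PAut \<Gamma>" \<Phi>
  by unfold_locales (rule \<Phi>_hom)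

context partition_system
begin

lemma \<Phi>_L:
  assumes "i < N"
  shows "\<Phi> (E.L (i, b)) = pc (i, b)"
  using assms \<Phi>_gen[OF assms] pconj_inv[of "(center i, True)" "piece i"] piece_part[OF assms]
  by (cases b) (simp_all add: E.L_False)

lemma \<Phi>_apply:
  "e \<in> carrier E \<Longrightarrow> e' \<in> carrier E \<Longrightarrow> g \<in> carrier G \<Longrightarrow>
    \<Phi> (e \<otimes>\<^bsub>E\<^esub> e') g = \<Phi> e (\<Phi> e' g)"
  by (simp add: PAut_apply)

section \<open>The homomorphism \<open>\<zeta>\<close> from \<open>G\<close>\<close>

definition indices :: "'a \<Rightarrow> nat list" where "indices v = filter (\<lambda>i. center i = v) [0..<N]"
abbreviation pos :: "nat list \<Rightarrow> nat word" where "pos \<equiv> map (\<lambda>i. (i, True))"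
abbreviation z where "z v \<equiv> E.cl (pos (indices v))"

lemma indices_set: "set (indices v) = {i. i < N \<and> center i = v}" and indices_distinct: "distinct (indices v)"
  by (auto simp: indices_def)

lemma pos_words [simp]: "pos is \<in> words {..<N} \<longleftrightarrow> set is \<subseteq> {..<N}"
  by (induction "is") auto

lemma pos_indices_words [simp]: "set (indices v) \<subseteq> {..<N}"
  by (auto simp: indices_set)

lemma E_commute_z:
  assumes "i < N" "w \<notin> piece i"
  shows "E.L (i, b) \<otimes>\<^bsub>E\<^esub> z w = z w \<otimes>\<^bsub>E\<^esub> E.L (i, b)"
proof (rule E.commute_cl)
  fix l assume "l \<in> set (pos (indices w))"
  then obtain j where j: "l = (j, True)" "j < N" "center j = w" by (auto simp: indices_set)
  show "E.L (i, b) \<otimes>\<^bsub>E\<^esub> E.L l = E.L l \<otimes>\<^bsub>E\<^esub> E.L (i, b)"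
    unfolding j(1) by (rule E_commute) (use assms j in auto)
qed (use assms in simp_all)

lemma z_commute:
  assumes "w \<in> st v"
  shows "z v \<otimes>\<^bsub>E\<^esub> z w = z w \<otimes>\<^bsub>E\<^esub> z v"
proof -
  have "z w \<otimes>\<^bsub>E\<^esub> z v = z v \<otimes>\<^bsub>E\<^esub> z w"
  proof (rule E.commute_cl)
    fix l assume "l \<in> set (pos (indices v))"
    then obtain i where i: "l = (i, True)" "i < N" "center i = v" by (auto simp: indices_set)
    then have "w \<notin> piece i" using piece_disjoint_st assms by blast
    with i E_commute_z show "z w \<otimes>\<^bsub>E\<^esub> E.L l = E.L l \<otimes>\<^bsub>E\<^esub> z w" by simp
  qed simp_all
  then show ?thesis by simp
qed

text \<open>A lift of \<open>inner\<close> through \<open>\<Phi>\<close>, as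
  \<open>\<Phi>_\<zeta>\<close> shows.\<close>

definition \<zeta> :: "'a word set \<Rightarrow> nat word set" where
  "\<zeta> = (SOME \<phi>. \<phi> \<in> hom G E \<and> (\<forall>v\<in>V. \<phi> (L (v, True)) = z v))"

lemma \<zeta>_hom: "\<zeta> \<in> hom G E" and \<zeta>_gen: "v \<in> V \<Longrightarrow> \<zeta> (L (v, True)) = z v"
proof -
  have "\<exists>\<phi>. \<phi> \<in> hom G E \<and> (\<forall>v\<in>V. \<phi> (L (v, True)) = z v)"
  proof (rule lift_hom[OF E.is_group, of "\<lambda>v. z v"])
    show "z v \<otimes>\<^bsub>E\<^esub> z w = z w \<otimes>\<^bsub>E\<^esub> z v" if "w \<in> lk v" for v w
      using that by (intro z_commute) (simp add: st_def)
  qed auto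
  from someI_ex[OF this]
  show "\<zeta> \<in> hom G E" "v \<in> V \<Longrightarrow> \<zeta> (L (v, True)) = z v" unfolding \<zeta>_def by auto
qed

end

sublocale partition_system \<subseteq> \<zeta>: group_hom G "RAAG \<Delta>" \<zeta>
  by unfold_locales (rule \<zeta>_hom)

context partition_system
begin

text \<open>Modulo the partial conjugations of the other parts with the same conjugating vertex, every
  generator is an inner automorphism.\<close>

lemma complement_factor:
  assumes i: "i < N"
  obtains r where "r \<in> carrier E" "E.L (i, b) = \<zeta> (L (center i, b)) \<otimes>\<^bsub>E\<^esub> r"
    "\<And>h. h \<in> carrier E \<Longrightarrow>
      (\<And>j. j < N \<Longrightarrow> center j = center i \<Longrightarrow> j \<noteq> i \<Longrightarrow> h \<otimes>\<^bsub>E\<^esub> E.L (j, True) = E.L (j, True) \<otimes>\<^bsub>E\<^esub> h) \<Longrightarrow>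
      h \<otimes>\<^bsub>E\<^esub> r = r \<otimes>\<^bsub>E\<^esub> h"
proof -
  have "i \<in> set (indices (center i))" using i by (simp add: indices_set)
  \<comment> \<open>Generators with a common center commute, so the factor \<open>i\<close> of
    \<open>z (center i)\<close> can be moved to the front. The product of the remaining factors, or
    its inverse for \<open>b = True\<close>, is the witness for \<open>r\<close>.\<close>
  then obtain l1 l2 where l: "indices (center i) = l1 @ i # l2" by (auto simp: in_set_conv_decomp)
  have sub: "set l1 \<subseteq> {..<N}" "set l2 \<subseteq> {..<N}" using pos_indices_words[of "center i"] l by auto
  have ni: "j < N \<and> center j = center i \<and> j \<noteq> i" if "j \<in> set (l1 @ l2)" for j
    using that indices_set[of "center i"] indices_distinct[of "center i"] unfolding l by auto
  let ?r = "E.cl (pos (l1 @ l2))"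
  have r: "?r \<in> carrier E" using sub by simp
  have comm: "h \<otimes>\<^bsub>E\<^esub> ?r = ?r \<otimes>\<^bsub>E\<^esub> h"
    if "h \<in> carrier E"
      "\<And>j. j < N \<Longrightarrow> center j = center i \<Longrightarrow> j \<noteq> i \<Longrightarrow> h \<otimes>\<^bsub>E\<^esub> E.L (j, True) = E.L (j, True) \<otimes>\<^bsub>E\<^esub> h" for h
  proof (rule E.commute_cl)
    fix l assume "l \<in> set (pos (l1 @ l2))"
    then obtain j where j: "l = (j, True)" "j \<in> set (l1 @ l2)" by auto
    show "h \<otimes>\<^bsub>E\<^esub> E.L l = E.L l \<otimes>\<^bsub>E\<^esub> h" unfolding j(1) using ni[OF j(2)] that(2) by blast
  qed (use that sub in simp_all)
  have own: "\<not> (center j \<in> piece i \<and> center i \<in> piece j)" if "center j = center i" for j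
    using that piece_disjoint_st[OF i] by auto
  have iL: "E.L (i, True) \<in> carrier E" using i by simp
  have "z (center i) = E.cl (pos l1) \<otimes>\<^bsub>E\<^esub> (E.L (i, True) \<otimes>\<^bsub>E\<^esub> E.cl (pos l2))"
    using sub i by (simp add: l E.cl_append E.cl_Cons[of "(i, True)" "pos l2"])
  also have "\<dots> = E.cl (pos l1) \<otimes>\<^bsub>E\<^esub> E.L (i, True) \<otimes>\<^bsub>E\<^esub> E.cl (pos l2)"
    using sub i by (simp add: E.m_assoc)
  also have "E.cl (pos l1) \<otimes>\<^bsub>E\<^esub> E.L (i, True) = E.L (i, True) \<otimes>\<^bsub>E\<^esub> E.cl (pos l1)"
  proof (rule E.commute_cl[symmetric])
    fix l assume "l \<in> set (pos l1)"
    then obtain j where j: "l = (j, True)" "j \<in> set (l1 @ l2)" by auto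
    show "E.L (i, True) \<otimes>\<^bsub>E\<^esub> E.L l = E.L l \<otimes>\<^bsub>E\<^esub> E.L (i, True)"
      unfolding j(1) using ni[OF j(2)] own i by (intro E_commute) blast+
  qed (use sub i in simp_all)
  finally have z: "z (center i) = E.L (i, True) \<otimes>\<^bsub>E\<^esub> ?r"
    using sub i by (simp add: E.cl_append E.m_assoc)
  have ir: "E.L (i, True) \<otimes>\<^bsub>E\<^esub> ?r = ?r \<otimes>\<^bsub>E\<^esub> E.L (i, True)"
    using comm[OF iL] own i E_commute by blast
  show thesis
  proof (cases b)
    case True
    show thesis
    proof (rule that[of "inv\<^bsub>E\<^esub> ?r"])
      show "inv\<^bsub>E\<^esub> ?r \<in> carrier E" using r by simp
      show "E.L (i, b) = \<zeta> (L (center i, b)) \<otimes>\<^bsub>E\<^esub> inv\<^bsub>E\<^esub> ?r"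
        using True z \<zeta>_gen center_V i r iL by (simp add: E.m_assoc)
      fix h assume h: "h \<in> carrier E"
        "\<And>j. j < N \<Longrightarrow> center j = center i \<Longrightarrow> j \<noteq> i \<Longrightarrow> h \<otimes>\<^bsub>E\<^esub> E.L (j, True) = E.L (j, True) \<otimes>\<^bsub>E\<^esub> h"
      then show "h \<otimes>\<^bsub>E\<^esub> inv\<^bsub>E\<^esub> ?r = inv\<^bsub>E\<^esub> ?r \<otimes>\<^bsub>E\<^esub> h"
        using E.commute_inv[of ?r h] comm[OF h] r by simp
    qed
  next
    case False
    show thesis
    proof (rule that[OF r _ comm])
      have "\<zeta> (L (center i, b)) = inv\<^bsub>E\<^esub> (?r \<otimes>\<^bsub>E\<^esub> E.L (i, True))"
        using False z ir \<zeta>_gen center_V i by (simp add: L_False)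
      then show "E.L (i, b) = \<zeta> (L (center i, b)) \<otimes>\<^bsub>E\<^esub> ?r"
        using False r iL i by (simp add: E.L_False E.inv_mult_group E.m_assoc)
    qed
  qed
qed

text \<open>Together with \<open>\<Phi>_\<zeta>\<close> below: \<^term>\<open>\<zeta>\<close> is a crossed module.\<close>

lemma \<zeta>_equivariant:
  assumes "e \<in> carrier E" "g \<in> carrier G"
  shows "e \<otimes>\<^bsub>E\<^esub> \<zeta> g \<otimes>\<^bsub>E\<^esub> inv\<^bsub>E\<^esub> e = \<zeta> (\<Phi> e g)"
  using assms
proof (induction arbitrary: g rule: E.gen_induct)
  case one
  then show ?case by (simp add: PAut_one)
next
  case (mult l e)
  obtain i b where l: "l = (i, b)" by fastforce
  have i: "i < N" using mult l by simp
  let ?s = "(center i, b)"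
  have p: "part (fst ?s) (piece i)" using piece_part i by simp
  interpret a: group_hom G G "pconj ?s (piece i)" using p by (rule pconj_group_hom)
  let ?c = "\<lambda>g. E.L l \<otimes>\<^bsub>E\<^esub> \<zeta> g \<otimes>\<^bsub>E\<^esub> inv\<^bsub>E\<^esub> (E.L l)"
  \<comment> \<open>For a single letter both sides are homomorphisms in \<open>g\<close>, so they
    are compared on the generators.\<close>
  have letter: "?c g = \<zeta> (\<Phi> (E.L l) g)" if "g \<in> carrier G" for g
  proof (rule hom_eqI[OF E.is_group _ _ _ that])
    show "?c \<in> hom G E" using mult by (intro homI) (simp_all add: E.m_assoc)
    show "(\<lambda>g. \<zeta> (\<Phi> (E.L l) g)) \<in> hom G E" using i l \<Phi>_L by (intro homI) simp_all
    fix w assume w: "w \<in> V"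
    show "?c (L (w, True)) = \<zeta> (\<Phi> (E.L l) (L (w, True)))"
    proof (cases "w \<in> piece i")
      case True
      obtain r where r: "r \<in> carrier E" "E.L (i, b) = \<zeta> (L (center i, b)) \<otimes>\<^bsub>E\<^esub> r"
        "\<And>h. h \<in> carrier E \<Longrightarrow>
          (\<And>j. j < N \<Longrightarrow> center j = center i \<Longrightarrow> j \<noteq> i \<Longrightarrow> h \<otimes>\<^bsub>E\<^esub> E.L (j, True) = E.L (j, True) \<otimes>\<^bsub>E\<^esub> h) \<Longrightarrow>
          h \<otimes>\<^bsub>E\<^esub> r = r \<otimes>\<^bsub>E\<^esub> h"
        using complement_factor[OF i] by metis
      \<comment> \<open>\<open>w\<close> lies in no other part of the same center, so
        \<open>z w\<close> commutes with the remaining generators there and hence with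
        \<open>r\<close>. The letter thus conjugates \<open>z w\<close> as
        \<open>\<zeta> (L (center i, b))\<close> does.\<close>
      have zr: "z w \<otimes>\<^bsub>E\<^esub> r = r \<otimes>\<^bsub>E\<^esub> z w"
      proof (rule r(3))
        fix j assume j: "j < N" "center j = center i" "j \<noteq> i"
        then have "w \<notin> piece j" using index_disjoint[of i j] True i by auto
        then show "z w \<otimes>\<^bsub>E\<^esub> E.L (j, True) = E.L (j, True) \<otimes>\<^bsub>E\<^esub> z w"
          using E_commute_z j by simp
      qed simp
      let ?a = "\<zeta> (L (center i, b))"
      have a: "?a \<in> carrier E" using i center_V by simp
      have "?c (L (w, True)) = ?a \<otimes>\<^bsub>E\<^esub> (r \<otimes>\<^bsub>E\<^esub> z w) \<otimes>\<^bsub>E\<^esub> inv\<^bsub>E\<^esub> r \<otimes>\<^bsub>E\<^esub> inv\<^bsub>E\<^esub> ?a"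
        using r(1) a w by (simp add: l r(2) \<zeta>_gen E.inv_mult_group E.m_assoc)
      also have "\<dots> = ?a \<otimes>\<^bsub>E\<^esub> z w \<otimes>\<^bsub>E\<^esub> inv\<^bsub>E\<^esub> ?a"
        unfolding zr[symmetric] using r(1) a by (simp add: E.m_assoc)
      also have "\<dots> = \<zeta> (conj_gen (L ?s) w)" using i center_V w by (simp add: \<zeta>_gen)
      finally show ?thesis using True p l \<Phi>_L i by (simp add: pconj_moves)
    next
      case False
      have "?c (L (w, True)) = z w \<otimes>\<^bsub>E\<^esub> E.L l \<otimes>\<^bsub>E\<^esub> inv\<^bsub>E\<^esub> (E.L l)"
        using E_commute_z[OF i False] w l by (simp add: \<zeta>_gen)
      then show ?thesis using p False w l \<Phi>_L i by (simp add: pconj_fixes \<zeta>_gen E.m_assoc)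
    qed
  qed
  have eg: "\<Phi> e g \<in> carrier G" using mult PAut_closed by simp
  have "E.L l \<otimes>\<^bsub>E\<^esub> e \<otimes>\<^bsub>E\<^esub> \<zeta> g \<otimes>\<^bsub>E\<^esub> inv\<^bsub>E\<^esub> (E.L l \<otimes>\<^bsub>E\<^esub> e)
      = E.L l \<otimes>\<^bsub>E\<^esub> (e \<otimes>\<^bsub>E\<^esub> \<zeta> g \<otimes>\<^bsub>E\<^esub> inv\<^bsub>E\<^esub> e) \<otimes>\<^bsub>E\<^esub> inv\<^bsub>E\<^esub> (E.L l)"
    using mult.hyps mult.prems by (simp add: E.inv_mult_group E.m_assoc)
  also have "\<dots> = \<zeta> (\<Phi> (E.L l \<otimes>\<^bsub>E\<^esub> e) g)"
    unfolding mult.IH[OF mult.prems] using mult.hyps mult.prems letter[OF eg] by (simp add: \<Phi>_apply del: \<Phi>.hom_mult)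
  finally show ?case .
qed

section \<open>The subgroup \<open>Z\<close> and its abelian quotient\<close>

abbreviation Z where "Z \<equiv> \<zeta> ` carrier G"

lemma Z_subgroup: "subgroup Z E"
  by (rule \<zeta>.img_is_subgroup)

lemma Z_conj: "e \<in> carrier E \<Longrightarrow> c \<in> Z \<Longrightarrow> e \<otimes>\<^bsub>E\<^esub> c \<otimes>\<^bsub>E\<^esub> inv\<^bsub>E\<^esub> e \<in> Z"
  using \<zeta>_equivariant PAut_closed by auto

text \<open>For non-commuting letters, write the first as \<open>\<zeta> a\<close> times
  \<open>r\<close>, where \<open>r\<close> commutes with the second. The commutator becomes
  \<open>\<zeta> a\<close> times a conjugate of \<open>\<zeta> (inv a)\<close>, and
  \<open>\<zeta>_equivariant\<close> puts the conjugate into \<open>Z\<close>.\<close>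

lemma letters_commute_mod_Z:
  assumes "i < N" "j < N"
  shows "E.L (i, b) \<otimes>\<^bsub>E\<^esub> E.L (j, c) \<otimes>\<^bsub>E\<^esub> inv\<^bsub>E\<^esub> E.L (i, b) \<otimes>\<^bsub>E\<^esub> inv\<^bsub>E\<^esub> E.L (j, c) \<in> Z"
proof (cases "center j \<in> piece i \<and> center i \<in> piece j")
  case False
  interpret Z: subgroup Z E by (rule Z_subgroup)
  have "E.L (i, b) \<otimes>\<^bsub>E\<^esub> E.L (j, c) = E.L (j, c) \<otimes>\<^bsub>E\<^esub> E.L (i, b)"
    using False assms E_commute by blast
  then have "E.L (i, b) \<otimes>\<^bsub>E\<^esub> E.L (j, c) \<otimes>\<^bsub>E\<^esub> inv\<^bsub>E\<^esub> E.L (i, b) \<otimes>\<^bsub>E\<^esub> inv\<^bsub>E\<^esub> E.L (j, c) = \<one>\<^bsub>E\<^esub>"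
    using assms by (simp add: E.m_assoc)
  then show ?thesis using Z.one_closed by simp
next
  case True
  let ?t = "E.L (j, c)"
  obtain r where r: "r \<in> carrier E" "E.L (i, b) = \<zeta> (L (center i, b)) \<otimes>\<^bsub>E\<^esub> r"
    "\<And>h. h \<in> carrier E \<Longrightarrow>
      (\<And>j. j < N \<Longrightarrow> center j = center i \<Longrightarrow> j \<noteq> i \<Longrightarrow> h \<otimes>\<^bsub>E\<^esub> E.L (j, True) = E.L (j, True) \<otimes>\<^bsub>E\<^esub> h) \<Longrightarrow>
      h \<otimes>\<^bsub>E\<^esub> r = r \<otimes>\<^bsub>E\<^esub> h"
    using complement_factor[OF assms(1)] by metis
  have tr: "?t \<otimes>\<^bsub>E\<^esub> r = r \<otimes>\<^bsub>E\<^esub> ?t"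
  proof (rule r(3))
    fix k assume k: "k < N" "center k = center i" "k \<noteq> i"
    then have "center j \<notin> piece k" using index_disjoint[of i k] True assms by auto
    then show "?t \<otimes>\<^bsub>E\<^esub> E.L (k, True) = E.L (k, True) \<otimes>\<^bsub>E\<^esub> ?t"
      using E_commute[of j k] assms k by simp
  qed (use assms in simp)
  let ?a = "L (center i, b)"
  have a: "?a \<in> carrier G" using assms center_V by simp
  have t: "?t \<in> carrier E" using assms by simp
  have b: "\<Phi> ?t (inv ?a) \<in> carrier G" using a t PAut_closed by simp
  have "E.L (i, b) \<otimes>\<^bsub>E\<^esub> ?t \<otimes>\<^bsub>E\<^esub> inv\<^bsub>E\<^esub> E.L (i, b) \<otimes>\<^bsub>E\<^esub> inv\<^bsub>E\<^esub> ?t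
      = \<zeta> ?a \<otimes>\<^bsub>E\<^esub> (r \<otimes>\<^bsub>E\<^esub> ?t) \<otimes>\<^bsub>E\<^esub> inv\<^bsub>E\<^esub> r \<otimes>\<^bsub>E\<^esub> inv\<^bsub>E\<^esub> \<zeta> ?a \<otimes>\<^bsub>E\<^esub> inv\<^bsub>E\<^esub> ?t"
    using r(1) a t by (simp add: r(2) E.inv_mult_group E.m_assoc)
  also have "\<dots> = \<zeta> ?a \<otimes>\<^bsub>E\<^esub> (?t \<otimes>\<^bsub>E\<^esub> \<zeta> (inv ?a) \<otimes>\<^bsub>E\<^esub> inv\<^bsub>E\<^esub> ?t)"
    unfolding tr[symmetric] using r(1) a t by (simp add: E.m_assoc)
  also have "\<dots> = \<zeta> (?a \<otimes> \<Phi> ?t (inv ?a))"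
    using a b t \<zeta>_equivariant[of ?t "inv ?a"] by simp
  finally show ?thesis using a b by (metis imageI m_closed)
qed

lemma commute_mod_Z:
  assumes "i < N" "e \<in> carrier E"
  shows "E.L (i, b) \<otimes>\<^bsub>E\<^esub> e \<otimes>\<^bsub>E\<^esub> inv\<^bsub>E\<^esub> E.L (i, b) \<otimes>\<^bsub>E\<^esub> inv\<^bsub>E\<^esub> e \<in> Z"
  using assms(2)
proof (induction rule: E.gen_induct)
  interpret Z: subgroup Z E by (rule Z_subgroup)
  case one
  then show ?case using assms Z.one_closed by simp
next
  interpret Z: subgroup Z E by (rule Z_subgroup)
  case (mult l e)
  let ?s = "E.L (i, b)" and ?l = "E.L l"
  have c: "?s \<in> carrier E" "?l \<in> carrier E" using assms mult by auto
  \<comment> \<open>The commutator identity [s, le] = [s, l] l [s, e] l^{-1}.\<close>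
  have "?s \<otimes>\<^bsub>E\<^esub> (?l \<otimes>\<^bsub>E\<^esub> e) \<otimes>\<^bsub>E\<^esub> inv\<^bsub>E\<^esub> ?s \<otimes>\<^bsub>E\<^esub> inv\<^bsub>E\<^esub> (?l \<otimes>\<^bsub>E\<^esub> e)
      = (?s \<otimes>\<^bsub>E\<^esub> ?l \<otimes>\<^bsub>E\<^esub> inv\<^bsub>E\<^esub> ?s \<otimes>\<^bsub>E\<^esub> inv\<^bsub>E\<^esub> ?l) \<otimes>\<^bsub>E\<^esub>
        (?l \<otimes>\<^bsub>E\<^esub> (?s \<otimes>\<^bsub>E\<^esub> e \<otimes>\<^bsub>E\<^esub> inv\<^bsub>E\<^esub> ?s \<otimes>\<^bsub>E\<^esub> inv\<^bsub>E\<^esub> e) \<otimes>\<^bsub>E\<^esub> inv\<^bsub>E\<^esub> ?l)"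
    using c mult by (simp add: E.inv_mult_group E.m_assoc)
  moreover have "?s \<otimes>\<^bsub>E\<^esub> ?l \<otimes>\<^bsub>E\<^esub> inv\<^bsub>E\<^esub> ?s \<otimes>\<^bsub>E\<^esub> inv\<^bsub>E\<^esub> ?l \<in> Z"
    using letters_commute_mod_Z[of i "fst l" b "snd l"] assms mult by simp
  ultimately show ?case using Z_conj[OF c(2) mult.IH] Z.m_closed by simp
qed

text \<open>Since the exponent sum vanishes, the first letter of a word has an opposite one later
  on. The two cancel modulo \<open>Z\<close>, as letters commute modulo \<open>Z\<close>, and the
  word gets shorter.\<close>

lemma zero_exponents_in_Z:
  assumes "e \<in> carrier E" "\<And>i. i < N \<Longrightarrow> E.expo i e = 0"
  shows "e \<in> Z"
proof -
  interpret Z: subgroup Z E by (rule Z_subgroup)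
  have "E.cl u \<in> Z" if "u \<in> words {..<N}" "\<And>i. i < N \<Longrightarrow> E.word_expo i u = 0" for u
    using that
  proof (induction "length u" arbitrary: u rule: less_induct)
    case less
    show ?case
    proof (cases u)
      case Nil
      then show ?thesis using Z.one_closed by simp
    next
      case (Cons l u')
      obtain i b where l: "l = (i, b)" by fastforce
      have i: "i < N" using less l Cons by simp
      have "(i, \<not> b) \<in> set u'" using E.opposite_letter_occurs less.prems(2)[OF i] l Cons by simp
      then obtain p q where pq: "u' = p @ (i, \<not> b) # q" by (auto simp: in_set_conv_decomp)
      have w: "p \<in> words {..<N}" "q \<in> words {..<N}" using less Cons pq by auto
      have "E.word_expo j (p @ q) = 0" if "j < N" for j
        using less.prems(2)[OF that] by (auto simp: Cons pq l E.word_expo_append split: if_splits)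
      then have IH: "E.cl (p @ q) \<in> Z" using less.hyps[of "p @ q"] w Cons pq by simp
      let ?s = "E.L (i, b)"
      have "E.cl u = ?s \<otimes>\<^bsub>E\<^esub> (E.cl p \<otimes>\<^bsub>E\<^esub> (inv\<^bsub>E\<^esub> ?s \<otimes>\<^bsub>E\<^esub> E.cl q))"
        using w i E.L_bar[of "(i, b)"] E.cl_Cons[of "(i, b)" "p @ (i, \<not> b) # q"]
          E.cl_Cons[of "(i, \<not> b)" q]
        by (simp add: Cons pq l E.cl_append)
      also have "\<dots> = (?s \<otimes>\<^bsub>E\<^esub> E.cl p \<otimes>\<^bsub>E\<^esub> inv\<^bsub>E\<^esub> ?s \<otimes>\<^bsub>E\<^esub> inv\<^bsub>E\<^esub> E.cl p) \<otimes>\<^bsub>E\<^esub> E.cl (p @ q)"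
        using w i by (simp add: E.m_assoc E.cl_append)
      finally show ?thesis using IH commute_mod_Z[OF i] w Z.m_closed by simp
    qed
  qed
  moreover obtain u where "u \<in> words {..<N}" "e = E.cl u" using assms E.elem_cases EV by metis
  ultimately show ?thesis using assms E.expo_cl by simp
qed

text \<open>Among the parts with center \<open>center i\<close> only \<open>piece i\<close> contains
  \<open>v\<close>, so only the letters \<open>i\<close> of \<open>e\<close> contribute to the
  exponent of \<open>center i\<close> in the conjugator; the partial conjugations applied afterwards
  preserve it.\<close>

lemma \<Phi>_conjugator:
  assumes "e \<in> carrier E" "i < N" "v \<in> piece i"
  shows "\<exists>g\<in>carrier G. \<Phi> e (L (v, True)) = conj_gen g v \<and> expo (center i) g = E.expo i e"
  using assms(1)
proof (induction rule: E.gen_induct)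
  have v: "v \<in> V" using piece_part assms by (auto simp: part_def)
  case one
  then show ?case using v by (intro bexI[of _ \<one>]) (simp_all add: PAut_one)
next
  have v: "v \<in> V" using piece_part assms by (auto simp: part_def)
  case (mult l e)
  obtain j b where l: "l = (j, b)" by fastforce
  have j: "j < N" using mult l by simp
  have p: "part (fst (center j, b)) (piece j)" using piece_part j by simp
  interpret a: group_hom G G "pconj (center j, b) (piece j)" using p by (rule pconj_group_hom)
  obtain g where g: "g \<in> carrier G" "\<Phi> e (L (v, True)) = conj_gen g v" "expo (center i) g = E.expo i e"
    using mult by blast
  define h where "h = (if v \<in> piece j then L (center j, b) else \<one>)"
  have h: "h \<in> carrier G" "pconj (center j, b) (piece j) (L (v, True)) = conj_gen h v"
    using p v j center_V by (auto simp: h_def pconj_moves pconj_fixes)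
  let ?g = "pconj (center j, b) (piece j) g \<otimes> h"
  have "\<Phi> (E.L l \<otimes>\<^bsub>E\<^esub> e) (L (v, True)) = pconj (center j, b) (piece j) (conj_gen g v)"
    using mult v g \<Phi>_L j l by (simp add: \<Phi>_apply del: \<Phi>.hom_mult)
  also have "\<dots> = conj_gen ?g v" using v g h by (simp add: inv_mult_group m_assoc)
  finally have "\<Phi> (E.L l \<otimes>\<^bsub>E\<^esub> e) (L (v, True)) = conj_gen ?g v" .
  moreover have "j = i" if "v \<in> piece j" "center j = center i"
    using index_disjoint[OF assms(2) j that(2)[symmetric]] assms(3) that(1) by blast
  then have "expo (center i) h = E.expo i (E.L l)"
    using assms j center_V by (auto simp: h_def l expo_L E.expo_L)
  then have "expo (center i) ?g = E.expo i (E.L l \<otimes>\<^bsub>E\<^esub> e)"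
    using g h mult.hyps expo_pconj[OF p g(1)] by simp
  moreover have "?g \<in> carrier G" using g h by simp
  ultimately show ?case by blast
qed

text \<open>For \<open>e\<close> in the kernel the conjugator of a vertex \<open>v\<close> of
  \<open>piece i\<close> centralizes \<open>v\<close>. It lies in \<open>sub (st v)\<close>, and
  \<open>st v\<close> does not contain \<open>center i\<close>.\<close>

lemma \<Phi>_kernel_exponents:
  assumes "e \<in> carrier E" "\<Phi> e = \<one>\<^bsub>PAut \<Gamma>\<^esub>" "i < N"
  shows "E.expo i e = 0"
proof -
  obtain v where v: "v \<in> piece i" using P_nonempty center_V piece_P assms by blast
  then have vV: "v \<in> V" "center i \<notin> st v" using piece_part[OF assms(3)] st_sym by (auto simp: part_def)
  obtain g where g: "g \<in> carrier G" "\<Phi> e (L (v, True)) = conj_gen g v" "expo (center i) g = E.expo i e"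
    using \<Phi>_conjugator assms v by blast
  have "conj_gen g v = L (v, True)" using g assms vV by (simp add: PAut_one)
  then have "g \<otimes> L (v, True) \<otimes> inv g \<otimes> g = L (v, True) \<otimes> g" by simp
  then have "g \<otimes> L (v, True) = L (v, True) \<otimes> g" using g vV by (simp add: m_assoc)
  then have "g \<in> sub (st v)" using centralizer_gen g vV by blast
  then show ?thesis using expo_sub st_subset vV g by simp
qed

text \<open>The parts at \<open>v\<close> are disjoint and do not contain \<open>v\<close>, so the
  factors do not interfere.\<close>

lemma \<Phi>_pos:
  assumes "distinct is" "set is \<subseteq> set (indices v)" "w \<in> V"
  shows "\<Phi> (E.cl (pos is)) (L (w, True))
    = (if \<exists>i\<in>set is. w \<in> piece i then conj_gen (L (v, True)) w else L (w, True))"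
  using assms(1,2)
proof (induction "is")
  case Nil
  then show ?case using assms by (simp add: PAut_one)
next
  case (Cons i "is")
  have i: "i < N" "center i = v" "v \<in> V" using Cons center_V by (auto simp: indices_set)
  have sub: "set is \<subseteq> {..<N}" using Cons by (auto simp: indices_set)
  have p: "part (fst (v, True)) (piece i)" using piece_part i by fastforce
  interpret a: group_hom G G "pconj (v, True) (piece i)" using p by (rule pconj_group_hom)
  have vC: "v \<notin> piece i" using p by (auto simp: part_def)
  have "\<Phi> (E.cl (pos (i # is))) (L (w, True)) = pconj (v, True) (piece i) (\<Phi> (E.cl (pos is)) (L (w, True)))"
    using E.cl_Cons[of "(i, True)" "pos is"] i sub assms \<Phi>_L[of i True]
    by (simp add: \<Phi>_apply del: \<Phi>.hom_mult)
  also have "\<dots> = (if \<exists>i\<in>set (i # is). w \<in> piece i then conj_gen (L (v, True)) w else L (w, True))"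
  proof (cases "\<exists>i\<in>set is. w \<in> piece i")
    case True
    then obtain k where k: "k \<in> set is" "w \<in> piece k" by blast
    then have "k < N" "center k = v" "k \<noteq> i" using Cons by (auto simp: indices_set)
    then have "w \<notin> piece i" using index_disjoint[of k i] i k by auto
    then show ?thesis using Cons True p i assms vC by (simp add: pconj_fixes)
  next
    case False
    then show ?thesis using Cons p i assms by (simp add: pconj_fixes pconj_moves)
  qed
  finally show ?case .
qed

text \<open>The parts at \<open>v\<close> cover the complement of \<open>st v\<close>, and on
  \<open>st v\<close> conjugation by \<open>v\<close> is trivial.\<close>

lemma \<Phi>_\<zeta>:
  assumes "g \<in> carrier G"
  shows "\<Phi> (\<zeta> g) = inner g"
proof -
  have "(\<Phi> \<circ> \<zeta>) g = inner g"
  proof (rule hom_eqI[OF group_PAut _ inner_hom _ assms])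
    show "\<Phi> \<circ> \<zeta> \<in> hom G (PAut \<Gamma>)" using \<zeta>_hom \<Phi>_hom by (rule Group.hom_compose)
    fix v assume v: "v \<in> V"
    have "\<Phi> (z v) (L (w, True)) = inner (L (v, True)) (L (w, True))" if w: "w \<in> V" for w
    proof (cases "w \<in> st v")
      case True
      have "\<not> (\<exists>i\<in>set (indices v). w \<in> piece i)" using True piece_disjoint_st by (auto simp: indices_set)
      then have "\<Phi> (z v) (L (w, True)) = L (w, True)"
        using \<Phi>_pos[OF indices_distinct subset_refl w] by simp
      moreover have "L (v, True) \<otimes> L (w, True) = L (w, True) \<otimes> L (v, True)"
        using L_commute[of "(v, True)" "(w, True)"] True st_sym w by simp
      ultimately show ?thesis using v w by (simp add: inner_def m_assoc)
    next
      case False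
      then obtain C where "C \<in> P v" "w \<in> C" using P_cover v w by blast
      then have "\<exists>i\<in>set (indices v). w \<in> piece i" using v index_exists[of v C] by (auto simp: indices_set)
      then show ?thesis using \<Phi>_pos[OF indices_distinct subset_refl w, of v] v w by (simp add: inner_def)
    qed
    then show "(\<Phi> \<circ> \<zeta>) (L (v, True)) = inner (L (v, True))"
      using v inner_PAut by (intro PAut_eqI) (simp_all add: \<zeta>_gen)
  qed
  then show ?thesis by simp
qed

text \<open>A central \<open>g\<close> lies in \<open>sub (st x)\<close> for every \<open>x\<close>,
  so its first letter comes from a vertex in every star. No non-empty part has this vertex as its
  center, so \<open>\<zeta>\<close> kills it. The tail of \<open>g\<close> is again central, and
  induction applies.\<close>

lemma \<zeta>_central:
  assumes "g \<in> carrier G" "\<And>x. x \<in> V \<Longrightarrow> g \<otimes> L (x, True) = L (x, True) \<otimes> g"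
  shows "\<zeta> g = \<one>\<^bsub>E\<^esub>"
  using assms
proof (induction "len g" arbitrary: g rule: less_induct)
  case less
  show ?case
  proof (cases "g = \<one>")
    case False
    then obtain t g' where t: "fst t \<in> V" "g' \<in> carrier G" "g = L t \<otimes> g'" "len g' < len g" "g \<in> H t"
      using first_letter less.prems by metis
    have cone: "fst t \<in> st x" if x: "x \<in> V" for x
    proof (rule ccontr)
      assume "fst t \<notin> st x"
      moreover obtain u where "u \<in> words (st x)" "g = cl u"
        using centralizer_gen[OF less.prems(1) x less.prems(2)[OF x]] by (auto simp: sub_def)
      moreover have "cl u \<in> carrier G" if "u \<in> words (st x)" for u
        using words_mono[OF that st_subset[OF x]] by simp
      \<comment> \<open>A path spelled within \<open>st x\<close> avoids the letter \<open>t\<close>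
        and cannot enter \<open>H t\<close>.\<close>
      ultimately have "g \<in> H t \<longleftrightarrow> \<one> \<in> H t"
        using H_stays[of \<one> \<one> u "st x" t] st_subset[OF x] t(1) by simp
      with t one_notin_H show False by blast
    qed
    have "g' \<otimes> L (x, True) = L (x, True) \<otimes> g'" if x: "x \<in> V" for x
    proof -
      have tx: "L t \<otimes> L (x, True) = L (x, True) \<otimes> L t" using L_commute[of t "(x, True)"] cone x by simp
      then have itx: "inv (L t) \<otimes> L (x, True) = L (x, True) \<otimes> inv (L t)"
        using commute_inv t x by simp
      have "L (x, True) \<otimes> (inv (L t) \<otimes> g) = inv (L t) \<otimes> g \<otimes> L (x, True)"
        using itx less.prems(2)[OF x] less.prems(1) t(1) x by (intro commute_mult) simp_all
      then show ?thesis using t by simp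
    qed
    then have "\<zeta> g' = \<one>\<^bsub>E\<^esub>" using less.hyps t by blast
    moreover have "\<zeta> (L t) = \<one>\<^bsub>E\<^esub>"
    proof -
      have "\<not> (i < N \<and> center i = fst t)" for i
      proof
        assume i: "i < N \<and> center i = fst t"
        then obtain w where "w \<in> piece i" using P_nonempty[OF center_V piece_P] by blast
        then have "w \<in> V" "fst t \<notin> st w"
          using piece_part[of i] i st_sym by (auto simp: part_def)
        with cone show False by blast
      qed
      then have "set (indices (fst t)) = {}" unfolding indices_set by blast
      then have "\<zeta> (L (fst t, True)) = \<one>\<^bsub>E\<^esub>" using \<zeta>_gen t by simp
      then show ?thesis using t L_False[of "fst t"] by (cases t; cases "snd t") simp_all
    qed
    ultimately show ?thesis using t by simp
  qed simp
qed

theorem \<Phi>_inj: "inj_on \<Phi> (carrier E)"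
  unfolding \<Phi>.inj_on_one_iff
proof (intro allI impI)
  fix e assume e: "e \<in> carrier E" "\<Phi> e = \<one>\<^bsub>PAut \<Gamma>\<^esub>"
  then have "e \<in> Z" using zero_exponents_in_Z \<Phi>_kernel_exponents by blast
  then obtain g where g: "g \<in> carrier G" "e = \<zeta> g" by blast
  then have inner: "inner g = \<one>\<^bsub>PAut \<Gamma>\<^esub>" using e \<Phi>_\<zeta> by simp
  have "g \<otimes> L (x, True) = L (x, True) \<otimes> g" if x: "x \<in> V" for x
  proof -
    have "inner g (L (x, True)) = \<one>\<^bsub>PAut \<Gamma>\<^esub> (L (x, True))" by (simp only: inner)
    then have "g \<otimes> L (x, True) \<otimes> inv g = L (x, True)" using x by (simp add: inner_def PAut_one)
    then have "g \<otimes> L (x, True) \<otimes> inv g \<otimes> g = L (x, True) \<otimes> g" by simp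
    then show ?thesis using g x by (simp add: m_assoc)
  qed
  then show "e = \<one>\<^bsub>E\<^esub>" using \<zeta>_central g by simp
qed

lemma Inn_subset: "Inn G \<subseteq> \<Phi> ` carrier E"
proof
  fix f assume "f \<in> Inn G"
  then obtain g where "g \<in> carrier G" "f = \<Phi> (\<zeta> g)" using \<Phi>_\<zeta> by (auto simp: Inn_eq)
  then show "f \<in> \<Phi> ` carrier E" by simp
qed

end

section \<open>Graphs without SIL-pairs\<close>

context raag
begin

text \<open>Outside the common link \<open>C\<close> is closed under adjacency, so the component of
  \<open>c\<close> in the induced subgraph stays in \<open>C\<close> and avoids both
  vertices.\<close>

lemma SIL_pairI:
  assumes V: "x \<in> V" "y \<in> V" "x \<noteq> y" "x \<notin> lk y"
    and c: "c \<in> C" "C \<subseteq> V - lk x \<inter> lk y" "x \<notin> C" "y \<notin> C"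
    and closed: "\<And>a u. a \<in> C \<Longrightarrow> u \<in> lk a \<Longrightarrow> u \<in> C \<or> u \<in> lk x \<inter> lk y"
  shows "SIL_pair \<Gamma> x y"
proof -
  interpret pg: pair_graph \<Gamma> by (rule pair_graph)
  let ?W = "V - lk x \<inter> lk y"
  let ?D = "with_proj \<Gamma> \<restriction> ?W"
  interpret D: wf_digraph ?D by (rule pg.wellformed_induce_subgraph)
  have cD: "c \<in> verts ?D" using c by auto
  have reach: "v \<in> C" if "c \<rightarrow>\<^sup>*\<^bsub>?D\<^esub> v" for v
    using that
  proof (induction rule: D.reachable_induct)
    case base
    show ?case by (rule c(1))
  next
    case (step u v)
    then have "(u, v) \<in> parcs \<Gamma>" "v \<in> ?W" by (auto simp: arcs_ends_def arc_to_ends_def)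
    then show ?case using closed[of u v] step by (auto simp: link_def)
  qed
  have "?D \<restriction> D.scc_of c \<in> pre_digraph.sccs ?D"
    by (rule D.in_verts_sccsD_sccs[OF D.scc_of_in_sccs_verts[OF cD]])
  moreover have "D.scc_of c \<subseteq> C" using reach by (auto simp: D.scc_of_def)
  ultimately show ?thesis
    using V c unfolding SIL_pair_def by (intro conjI bexI[of _ "?D \<restriction> D.scc_of c"]) auto
qed

text \<open>A vertex of \<open>component x c\<close> in \<open>st y\<close> would be adjacent to
  \<open>y\<close> and pull \<open>y\<close>, which is outside \<open>st x\<close>, into the
  component. Hence paths inside the component also avoid \<open>st y\<close>.\<close>

lemma component_mono_nonadjacent:
  assumes "y \<notin> st x" "c \<in> V - st x" "y \<in> V" "y \<notin> component x c"
  shows "component x c \<subseteq> component y c" "component x c \<inter> st y = {}"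
proof -
  have disj: "z \<notin> st y" if "z \<in> component x c" for z
  proof
    assume "z \<in> st y"
    then have "y \<in> lk z" using that assms st_sym by (auto simp: st_def)
    then show False using component_step[OF that _ \<open>y \<in> lk z\<close> assms(1)]
        component_subset[OF assms(2)] that assms(4) by blast
  qed
  then show "component x c \<inter> st y = {}" by blast
  show "component x c \<subseteq> component y c"
  proof
    fix z assume "z \<in> component x c"
    then show "z \<in> component y c"
    proof (induction rule: component_induct)
      case (step z u)
      moreover have "u \<in> component x c" using component_step step by blast
      ultimately show ?case using component_step[of z y c u] disj by blast
    qed simp
  qed
qed

text \<open>If \<open>x\<close> is in \<open>component y c\<close>, this component is
  \<open>component y d\<close> and contains \<open>component x c\<close>. Otherwise
  \<open>component_mono_nonadjacent\<close> applies both ways and the components of \<open>c\<close>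
  for \<open>x\<close> and \<open>y\<close> coincide. All neighbours of this set outside it are in
  both links, so \<open>x\<close> and \<open>y\<close> form a SIL-pair.\<close>

lemma components_nested:
  assumes "\<not> SIL_pair \<Gamma> x y" and V: "x \<in> V" "y \<in> V" "y \<notin> st x"
    and c: "c \<in> V - st x" "y \<notin> component x c"
    and d: "d \<in> V - st y" "x \<in> component y d"
  shows "component x c \<subseteq> component y d"
proof (cases "x \<in> component y c")
  case True
  then have "component y c = component y d" using component_eq d by metis
  then show ?thesis using component_mono_nonadjacent V c by metis
next
  case False
  have yx: "x \<notin> st y" using V st_sym by blast
  have cy: "c \<in> V - st y" using component_mono_nonadjacent(2)[OF V(3) c(1) V(2) c(2)] c component_refl by blast
  have eq: "component x c = component y c"
    using component_mono_nonadjacent(1)[OF V(3) c(1) V(2) c(2)]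
      component_mono_nonadjacent(1)[OF yx cy V(1) False] by blast
  have "SIL_pair \<Gamma> x y"
  proof (rule SIL_pairI[of x y c "component x c"])
    show "component x c \<subseteq> V - lk x \<inter> lk y"
      using component_subset[OF c(1)] by (auto simp: st_def)
    show "x \<notin> component x c" using component_subset[OF c(1)] by auto
    fix a u assume a: "a \<in> component x c" "u \<in> lk a"
    have aV: "a \<notin> st x" "a \<notin> st y"
      using component_subset[OF c(1)] component_subset[OF cy] a eq by auto
    then have "u \<noteq> x" "u \<noteq> y" using a lk_sym by (auto simp: st_def)
    moreover have "u \<in> component x c" if "u \<notin> st x" using component_step a aV that by blast
    moreover have "u \<in> component x c" if "u \<notin> st y"
      using component_step[of a y c u] a aV that eq by blast
    ultimately show "u \<in> component x c \<or> u \<in> lk x \<inter> lk y" by (auto simp: st_def)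
  qed (use V yx c in \<open>auto simp: st_def\<close>)
  with assms(1) show ?thesis by simp
qed

section \<open>The two embeddings\<close>

lemma finite_numbering:
  fixes P :: "'a \<Rightarrow> 'a set set"
  assumes "\<forall>x\<in>V. \<forall>C\<in>P x. C \<subseteq> V"
  shows "\<exists>h (N :: nat). bij_betw h {..<N} (SIGMA x:V. P x)"
proof -
  have "(SIGMA x:V. P x) \<subseteq> V \<times> Pow V" using assms by auto
  then have "finite (SIGMA x:V. P x)" using finite_V finite_subset by blast
  from ex_bij_betw_nat_finite[OF this] show ?thesis by (auto simp: atLeast0LessThan)
qed

lemma components_embedding:
  assumes "\<And>x y. \<not> SIL_pair \<Gamma> x y"
  shows "\<exists>(\<Gamma>' :: nat pair_pre_digraph) \<phi>. pair_graph \<Gamma>' \<and> \<phi> \<in> hom (RAAG \<Gamma>') (PAut \<Gamma>) \<and>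
    inj_on \<phi> (carrier (RAAG \<Gamma>')) \<and> \<phi> ` carrier (RAAG \<Gamma>') = carrier (PAut \<Gamma>)"
proof -
  define P where "P x = component x ` (V - st x)" for x
  have "\<forall>x\<in>V. \<forall>C\<in>P x. C \<subseteq> V" using component_subset unfolding P_def by blast
  then obtain h and N :: nat where "bij_betw h {..<N} (SIGMA x:V. P x)"
    using finite_numbering by blast
  then have n: "bij_betw (\<lambda>i. (fst (h i), snd (h i))) {..<N} (SIGMA x:V. P x)" by simp
  interpret partition_system \<Gamma> G P N "\<lambda>i. fst (h i)" "\<lambda>i. snd (h i)"
  proof
    show "part x C" if "x \<in> V" "C \<in> P x" for x C
      using that part_component by (auto simp: P_def)
    show "C \<noteq> {}" if "x \<in> V" "C \<in> P x" for x C
      using that component_refl unfolding P_def by blast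
    show "\<exists>C\<in>P x. y \<in> C" if "x \<in> V" "y \<in> V - st x" for x y
      using that component_refl[of y x] unfolding P_def by blast
    show "C \<inter> D = {}" if "C \<in> P x" "D \<in> P x" "C \<noteq> D" for x C D
      using that component_eq unfolding P_def by blast
    \<comment> \<open>The absence of SIL-pairs enters here.\<close>
    show "C \<subseteq> D" if "x \<in> V" "y \<in> V" "y \<notin> st x" "C \<in> P x" "y \<notin> C" "D \<in> P y" "x \<in> D" for x y C D
      using that components_nested[OF assms] unfolding P_def by blast
  qed (rule n)
  \<comment> \<open>Every generator in Laurence's theorem is the image of a letter, which gives
    surjectivity.\<close>
  have "pconj s (component (fst s) y) \<in> \<Phi> ` carrier E" if s: "fst s \<in> V" "y \<in> V - st (fst s)" for s y
  proof -
    have "component (fst s) y \<in> P (fst s)" using s by (simp add: P_def)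
    then obtain i where i: "i < N" "fst (h i) = fst s" "snd (h i) = component (fst s) y"
      using index_exists s(1) by blast
    then have "\<Phi> (E.L (i, snd s)) = pconj s (component (fst s) y)" using \<Phi>_L by simp
    moreover have "E.L (i, snd s) \<in> carrier E" using i by simp
    ultimately show ?thesis by (metis imageI)
  qed
  then have "\<Phi> ` carrier E = carrier (PAut \<Gamma>)"
    by (rule partial_conjugations_generate[OF \<Phi>.img_is_subgroup])
  with pair_graph_\<Delta> \<Phi>_hom \<Phi>_inj show ?thesis by blast
qed

lemma inner_embedding: "\<exists>(\<Gamma>' :: nat pair_pre_digraph) \<phi>. pair_graph \<Gamma>' \<and> \<phi> \<in> hom (RAAG \<Gamma>') (PAut \<Gamma>) \<and>
    inj_on \<phi> (carrier (RAAG \<Gamma>')) \<and> \<phi> ` carrier (RAAG \<Gamma>') = Inn G"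
proof -
  \<comment> \<open>For a vertex adjacent to all others the complement of the star is empty and is
    dropped, since parts must be non-empty. With at most one part per vertex the premises of
    \<open>P_nested\<close> are contradictory.\<close>
  define P where "P x = {V - st x} - {{}}" for x
  have "\<forall>x\<in>V. \<forall>C\<in>P x. C \<subseteq> V" unfolding P_def by blast
  then obtain h and N :: nat where "bij_betw h {..<N} (SIGMA x:V. P x)"
    using finite_numbering by blast
  then have n: "bij_betw (\<lambda>i. (fst (h i), snd (h i))) {..<N} (SIGMA x:V. P x)" by simp
  interpret partition_system \<Gamma> G P N "\<lambda>i. fst (h i)" "\<lambda>i. snd (h i)"
  proof
    show "part x C" if "x \<in> V" "C \<in> P x" for x C
      using that lk_V by (auto simp: P_def part_def)
  qed (use n in \<open>auto simp: P_def\<close>)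
  \<comment> \<open>Conjugating the whole complement of the star of \<open>x\<close> by
    \<open>x\<close> is inner, as \<open>x\<close> commutes with its star.\<close>
  have letter: "\<Phi> (E.L l) = inner (L (fst (h (fst l)), snd l))" if l: "fst l < N" for l
  proof (rule PAut_eqI)
    obtain i b where ib: "l = (i, b)" by fastforce
    have i: "i < N" "snd (h i) = V - st (fst (h i))" using l ib piece_P[of i] by (auto simp: P_def)
    have p: "part (fst (fst (h i), b)) (snd (h i))" using piece_part[OF i(1)] by simp
    fix w assume w: "w \<in> V"
    show "\<Phi> (E.L l) (L (w, True)) = inner (L (fst (h (fst l)), snd l)) (L (w, True))"
    proof (cases "w \<in> st (fst (h i))")
      case True
      then have "L (fst (h i), b) \<otimes> L (w, True) = L (w, True) \<otimes> L (fst (h i), b)"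
        using L_commute[of "(fst (h i), b)" "(w, True)"] st_sym w by simp
      then have "inner (L (fst (h i), b)) (L (w, True)) = L (w, True)"
        using w center_V i by (simp add: inner_def m_assoc)
      then show ?thesis using True w p i ib \<Phi>_L by (simp add: pconj_fixes)
    next
      case False
      then show ?thesis using w p i ib \<Phi>_L center_V by (simp add: pconj_moves inner_def)
    qed
  qed (use l center_V inner_PAut in simp_all)
  interpret I: subgroup "Inn G" "PAut \<Gamma>" using Inn_normal by (rule normal_imp_subgroup)
  have "\<Phi> e \<in> Inn G" if "e \<in> carrier E" for e
    using that
  proof (induction rule: E.gen_induct)
    case (mult l e)
    then show ?case using letter[of l] center_V by (auto simp: Inn_eq intro!: I.m_closed[unfolded Inn_eq])
  qed (use I.one_closed in simp)
  then have "\<Phi> ` carrier E = Inn G" using Inn_subset by blast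
  with pair_graph_\<Delta> \<Phi>_hom \<Phi>_inj show ?thesis by blast
qed

end

theorem theorem1p4:
  fixes \<Gamma> :: "'a pair_pre_digraph"
  assumes "pair_graph \<Gamma>"
    and "Digraph_Component.connected (with_proj \<Gamma>)"
  shows "\<exists>(\<Gamma>' :: nat pair_pre_digraph) \<phi>.
    pair_graph \<Gamma>' \<and>
    \<phi> \<in> hom (RAAG \<Gamma>') (PAut \<Gamma>) \<and>
    inj_on \<phi> (carrier (RAAG \<Gamma>')) \<and>
    \<phi> ` carrier (RAAG \<Gamma>') \<lhd> PAut \<Gamma> \<and>
    Inn (RAAG \<Gamma>) \<subseteq> \<phi> ` carrier (RAAG \<Gamma>') \<and>
    ((\<nexists>v w. SIL_pair \<Gamma> v w) \<longrightarrow> \<phi> \<in> iso (RAAG \<Gamma>') (PAut \<Gamma>))"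
proof -
  interpret raag \<Gamma> "RAAG \<Gamma>" by (rule raag.intro) (simp_all add: assms(1))
  show ?thesis
  proof (cases "\<exists>v w. SIL_pair \<Gamma> v w")
    case True
    \<comment> \<open>The premise of the isomorphism claim fails here, so the image may be as small
      as \<open>Inn (RAAG \<Gamma>)\<close>.\<close>
    obtain \<Gamma>' :: "nat pair_pre_digraph" and \<phi> where "pair_graph \<Gamma>'"
      "\<phi> \<in> hom (RAAG \<Gamma>') (PAut \<Gamma>)" "inj_on \<phi> (carrier (RAAG \<Gamma>'))"
      "\<phi> ` carrier (RAAG \<Gamma>') = Inn (RAAG \<Gamma>)"
      using inner_embedding by blast
    with True Inn_normal show ?thesis by (intro exI[of _ \<Gamma>'] exI[of _ \<phi>]) simp
  next
    case False
    then obtain \<Gamma>' :: "nat pair_pre_digraph" and \<phi> where "pair_graph \<Gamma>'"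
      "\<phi> \<in> hom (RAAG \<Gamma>') (PAut \<Gamma>)" "inj_on \<phi> (carrier (RAAG \<Gamma>'))"
      "\<phi> ` carrier (RAAG \<Gamma>') = carrier (PAut \<Gamma>)"
      using components_embedding by blast
    moreover have "carrier (PAut \<Gamma>) \<lhd> PAut \<Gamma>"
      by (simp add: PAut.normal_inv_iff PAut.subgroup_self)
    moreover have "Inn (RAAG \<Gamma>) \<subseteq> carrier (PAut \<Gamma>)" using inner_PAut by (auto simp: Inn_eq)
    ultimately show ?thesis
      by (intro exI[of _ \<Gamma>'] exI[of _ \<phi>]) (simp add: iso_def bij_betw_def)
  qed
qed

end
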